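(* Let $G$ be a finite graph cellularly embedded in a compact, connected, orientable, boundaryless surface $\Sigma$ of genus $g\ge0$, with dual graph $G^*$ and positive coupling constants $(J_{e^*})_{e^*\in E^*}$. 1. The double Ising partition function and the dimer model partition function are equal up to an explicit constant: $$Z_{\mathrm{d\text{-}Ising}}(G^*,J)=2^{|V^*|+2g}\Bigl(\prod_{e\in E}\cosh(2J_{e^*})\Bigr)Z^0_{\mathrm{quadri}}(G^Q,J).$$ 2. XOR-polygon configurations of the double Ising model on $G^*$ have the same law as $\mathrm{Poly}_1$ configurations of the corresponding dimer model on the bipartite graph $G^Q$: $$\forall P\in\mathcal P^0(G),\qquad\mathbb P_{\mathrm{d\text{-}Ising}}[\mathrm{XOR}=P]=\mathbb P^0_{\mathrm{quadri}}[\mathrm{Poly}_1=P].$$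
   Context: $G=(V,E)$, $G^*=(V^*,E^* )$, $e\mapsto e^*$ the bijection between edges and dual edges. A polygon configuration of $G$ is a subset of edges with even degree at every vertex; $\mathcal P^\epsilon(G)$ is the set of those with class $\epsilon\in H_1(\Sigma;\mathbb Z/2\mathbb Z)$. Double Ising model: for each $\epsilon\in H_1(\Sigma;\mathbb Z/2\mathbb Z)$ fix a representative $\underline\epsilon\subset E$, with $s_\epsilon(e)=-1$ if $e\in\underline\epsilon$ and $1$ otherwise, and let $Z^\epsilon_{\mathrm{Ising}}(G^*,J)=\sum_{\sigma\in\{-1,1\}^{V^*}}\exp(\sum_{e^*=u^*v^*}s_\epsilon(e)J_{e^*}\sigma_{u^*}\sigma_{v^*})$. Then $Z_{\mathrm{d\text{-}Ising}}(G^*,J)=\sum_\epsilon (Z^\epsilon_{\mathrm{Ising}}(G^*,J))^2$. $\mathbb P_{\mathrm{d\text{-}Ising}}$ is the probability measure on $\bigcup_\epsilon\mathcal P^\epsilon(G)\times\mathcal P^\epsilon(G)$ giving $(P_{\mathrm{red}},P_{\mathrm{blue}})$ probability $(2\prod_{e\in E}e^{J_{e^*}})^2\prod_{e\in P_{\mathrm{red}}}e^{-2J_{e^*}}\prod_{e\in P_{\mathrm{blue}}}e^{-2J_{e^*}}/Z_{\mathrm{d\text{-}Ising}}(G^*,J)$. A pair in $\mathcal P^\epsilon(G)^2$ comes from spin configurations $\sigma,\sigma'$ (each unique up to global sign) with $P_{\mathrm{red}}=\{e:s_\epsilon(e)\sigma_{u^*}\sigma_{v^*}=-1,\ e^*=u^*v^*\}$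 and similarly for $P_{\mathrm{blue}},\sigma'$. $\mathrm{XOR}(P_{\mathrm{red}},P_{\mathrm{blue}})$ is the set of edges $e$ of $G$ such that $\sigma\sigma'$ takes distinct values at the endpoints of $e^*$ (independent of choices). Medial graph $G^M$: it has one (4-valent) vertex $v(e)$ per edge $e$ of $G$, and two medial vertices are joined by an edge through each corner of a face at which the corresponding edges of $G$ are consecutive. The four medial edges at $v(e)$ lie in the four sectors delimited by $e$ and $e^*$. Quadri-tiling graph $G^Q$: it is obtained from $G^M$ by replacing each vertex $v(e)$ by a quadrangle (4-cycle) whose four corners are attached, in cyclic order, to the four medial edges at $v(e)$. It is bipartite. Edges coming from $G^M$ are external, edges of quadrangles are internal. In the quadrangle of $v(e)$, two internal edges are parallel to $e$ (each joins two corners on the same side of $e$) and two are parallel to $e^*$ (each joins two corners on the same side of $e^*$). Dimer configurations (perfect matchings) of $G^Q$ have weight equal to the product of their edge weights: $1$ for external edges, $a_e=\frac{2e^{-2J_{e^*}}}{1+e^{-4J_{e^*}}}$ for internal edges parallel to $e\in E$, and $b_{e^*}=\frac{1-e^{-4J_{e^*}}}{1+e^{-4J_{e^*}}}$ for internal edges parallel to $e^*\in E^*$. Given a dimer configuration $M$, its external edges form an edge configuration of $G^M$ such that around each vertex none, all, or exactly two consecutive edges are present. $\mathrm{Poly}_1(M)\subset E$ is the set of $e\in E$ such that exactly two medial edges at $v(e)$ are present and $e$ separates these from the two absent ones. $Z^0_{\mathrm{quadri}}(G^Q,J)$ is the sum of weights of dimer configurations $M$ with $\mathrm{Poly}_1(M)$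 of zero class in $H_1(\Sigma;\mathbb Z/2\mathbb Z)$, and $\mathbb P^0_{\mathrm{quadri}}$ is the probability measure on these configurations proportional to the weight. *)

theory Defs
  imports "HOL-Analysis.Analysis" "HOL-Combinatorics.Permutations" "HOL-Combinatorics.Orbits"
begin

section \<open>Cellularly embedded graphs as combinatorial maps\<close>

text \<open>
  A finite connected graph with at least one edge, cellularly embedded in an oriented closed surface,
  is encoded by its rotation system. The darts are the oriented edges (half-edges);
  \<open>rot d\<close> is the dart that follows \<open>d\<close> in counterclockwise order around the origin of \<open>d\<close>, and
  \<open>opp d\<close> is \<open>d\<close> with reversed orientation. Vertices are the orbits of \<open>rot\<close>.
  Loops and multiple edges are allowed.
\<close>

record 'd cmap =
  darts :: "'d set"
  rot :: "'d \<Rightarrow> 'd"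
  opp :: "'d \<Rightarrow> 'd"

definition cellular_map :: "'d cmap \<Rightarrow> bool" where
  "cellular_map G \<longleftrightarrow>
     finite (darts G) \<and> darts G \<noteq> {} \<and>
     rot G permutes darts G \<and> opp G permutes darts G \<and>
     (\<forall>d\<in>darts G. opp G (opp G d) = d \<and> opp G d \<noteq> d) \<and>
     (\<forall>x\<in>darts G. \<forall>y\<in>darts G.
        (x, y) \<in> ({(d, rot G d) | d. d \<in> darts G} \<union> {(d, opp G d) | d. d \<in> darts G})\<^sup>*)"

definition vertex_at :: "'d cmap \<Rightarrow> 'd \<Rightarrow> 'd set" where
  "vertex_at G d = orbit (rot G) d"

definition verts :: "'d cmap \<Rightarrow> 'd set set" where
  "verts G = vertex_at G ` darts G"

definition edge_at :: "'d cmap \<Rightarrow> 'd \<Rightarrow> 'd set" where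
  "edge_at G d = {d, opp G d}"

definition edges :: "'d cmap \<Rightarrow> 'd set set" where
  "edges G = edge_at G ` darts G"

text \<open>
  As a dart of the dual graph, \<open>d\<close> starts in the face to the left of \<open>d\<close> and crosses \<open>d\<close>.
  Turning counterclockwise around that face is following its boundary with the face on the left:
  from \<open>d\<close>, the next dart is the clockwise neighbour of \<open>opp d\<close> around the head of \<open>d\<close>.
  Hence \<open>vertex_at (dual G) d\<close> is the face to the left of \<open>d\<close>, and the dual edge of
  \<open>e = {d, opp d}\<close> is the same set of darts, which is how the bijection between edges
  and dual edges is represented: it is the identity.
\<close>

definition dual :: "'d cmap \<Rightarrow> 'd cmap" where
  "dual G = G\<lparr>rot := inv (rot G) \<circ> opp G\<rparr>"

definition euler_char :: "'d cmap \<Rightarrow> int" where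
  "euler_char G = int (card (verts G)) - int (card (edges G)) + int (card (verts (dual G)))"


section \<open>Polygon configurations and homology with coefficients modulo 2\<close>

text \<open>Counting darts makes a loop contribute 2 to the degree.\<close>

definition polygons :: "'d cmap \<Rightarrow> 'd set set set" where
  "polygons G = {P. P \<subseteq> edges G \<and> (\<forall>v\<in>verts G. even (card {d\<in>v. edge_at G d \<in> P}))}"

text \<open>
  Cellular homology of the surface: a chain is a set of cells, addition is symmetric difference.
  An edge with the same face on both sides is not in the boundary of that face.
\<close>

definition face_boundary :: "'d cmap \<Rightarrow> 'd set set \<Rightarrow> 'd set set" where
  "face_boundary G S = {e\<in>edges G. odd (card {d\<in>e. vertex_at (dual G) d \<in> S})}"

definition homologous :: "'d cmap \<Rightarrow> ('d set set \<times> 'd set set) set" where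
  "homologous G = {(P, Q). P \<in> polygons G \<and> Q \<in> polygons G \<and>
     (\<exists>S \<subseteq> verts (dual G). (P - Q) \<union> (Q - P) = face_boundary G S)}"

definition H1 :: "'d cmap \<Rightarrow> 'd set set set set" where
  "H1 G = polygons G // homologous G"

definition hclass :: "'d cmap \<Rightarrow> 'd set set \<Rightarrow> 'd set set set" where
  "hclass G P = homologous G `` {P}"

definition polygons_of_class :: "'d cmap \<Rightarrow> 'd set set set \<Rightarrow> 'd set set set" where
  "polygons_of_class G \<epsilon> = {P\<in>polygons G. hclass G P = \<epsilon>}"

definition zero_class :: "'d cmap \<Rightarrow> 'd set set set" where
  "zero_class G = hclass G {}"


section \<open>Ising and double Ising models\<close>

definition twist_sign :: "'d set set \<Rightarrow> 'd set \<Rightarrow> real" where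
  "twist_sign R e = (if e \<in> R then -1 else 1)"

definition spins :: "'d cmap \<Rightarrow> ('d set \<Rightarrow> real) set" where
  "spins H = verts H \<rightarrow>\<^sub>E {-1, 1}"

text \<open>
  The two darts of an edge \<open>uv\<close> have origins \<open>u\<close> and \<open>v\<close>, so this is the product of the spins at \<open>u\<close>
  and \<open>v\<close> (also when \<open>u = v\<close>).
\<close>

definition edge_spin :: "'d cmap \<Rightarrow> ('d set \<Rightarrow> real) \<Rightarrow> 'd set \<Rightarrow> real" where
  "edge_spin H \<sigma> e = (\<Prod>d\<in>e. \<sigma> (vertex_at H d))"

definition Z_Ising :: "'d cmap \<Rightarrow> 'd set set \<Rightarrow> ('d set \<Rightarrow> real) \<Rightarrow> real" where
  "Z_Ising H R J =
     (\<Sum>\<sigma>\<in>spins H. exp (\<Sum>e\<in>edges H. twist_sign R e * J e * edge_spin H \<sigma> e))"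

text \<open>
  Below, \<open>rep\<close> is the choice of a representative of each homology class, and \<open>J e\<close> is the coupling
  constant of the dual edge of \<open>e\<close>.
\<close>

definition Z_dIsing ::
    "'d cmap \<Rightarrow> ('d set set set \<Rightarrow> 'd set set) \<Rightarrow> ('d set \<Rightarrow> real) \<Rightarrow> real" where
  "Z_dIsing G rep J = (\<Sum>\<epsilon>\<in>H1 G. (Z_Ising (dual G) (rep \<epsilon>) J)\<^sup>2)"

definition dIsing_configs :: "'d cmap \<Rightarrow> ('d set set \<times> 'd set set) set" where
  "dIsing_configs G = (\<Union>\<epsilon>\<in>H1 G. polygons_of_class G \<epsilon> \<times> polygons_of_class G \<epsilon>)"

definition dIsing_weight ::
    "'d cmap \<Rightarrow> ('d set \<Rightarrow> real) \<Rightarrow> 'd set set \<times> 'd set set \<Rightarrow> real" where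
  "dIsing_weight G J = (\<lambda>(P_red, P_blue).
     (2 * (\<Prod>e\<in>edges G. exp (J e)))\<^sup>2 *
     (\<Prod>e\<in>P_red. exp (- 2 * J e)) * (\<Prod>e\<in>P_blue. exp (- 2 * J e)))"

definition dIsing_measure ::
    "'d cmap \<Rightarrow> ('d set set set \<Rightarrow> 'd set set) \<Rightarrow> ('d set \<Rightarrow> real) \<Rightarrow>
      ('d set set \<times> 'd set set) measure" where
  "dIsing_measure G rep J =
     point_measure (dIsing_configs G) (\<lambda>w. ennreal (dIsing_weight G J w / Z_dIsing G rep J))"

definition spin_polygon ::
    "'d cmap \<Rightarrow> 'd set set \<Rightarrow> ('d set \<Rightarrow> real) \<Rightarrow> 'd set set" where
  "spin_polygon G R \<sigma> = {e\<in>edges G. twist_sign R e * edge_spin (dual G) \<sigma> e = -1}"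

text \<open>A spin configuration inducing \<open>P\<close>; it is unique up to a global sign.\<close>

definition spin_of ::
    "'d cmap \<Rightarrow> ('d set set set \<Rightarrow> 'd set set) \<Rightarrow> 'd set set \<Rightarrow> ('d set \<Rightarrow> real)" where
  "spin_of G rep P =
     (SOME \<sigma>. \<sigma> \<in> spins (dual G) \<and> spin_polygon G (rep (hclass G P)) \<sigma> = P)"

definition xor_polygon ::
    "'d cmap \<Rightarrow> ('d set set set \<Rightarrow> 'd set set) \<Rightarrow> 'd set set \<times> 'd set set \<Rightarrow> 'd set set" where
  "xor_polygon G rep = (\<lambda>(P_red, P_blue).
     let \<tau> = (\<lambda>f. spin_of G rep P_red f * spin_of G rep P_blue f)
     in {e\<in>edges G. \<exists>d\<in>e. \<exists>d'\<in>e. \<tau> (vertex_at (dual G) d) \<noteq> \<tau> (vertex_at (dual G) d')})"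


section \<open>The quadri-tiling graph and its dimer model\<close>

text \<open>
  The four sectors delimited by an edge \<open>e = {d, opp d}\<close> and its dual are \<open>(d, Lft)\<close>, \<open>(d, Rgt)\<close>,
  \<open>(opp d, Lft)\<close>, \<open>(opp d, Rgt)\<close>, where \<open>(d, Lft)\<close> (resp. \<open>(d, Rgt)\<close>) is adjacent to the half of
  \<open>e\<close> at the origin of \<open>d\<close> and lies to the left (resp. right) of \<open>d\<close>. So \<open>(d, Lft)\<close> and
  \<open>(opp d, Rgt)\<close> are on the same side of \<open>e\<close>, while \<open>(d, Lft)\<close> and \<open>(d, Rgt)\<close> are on the
  same side of the dual of \<open>e\<close>. The sectors of \<open>e\<close> are the corners of its quadrangle.
\<close>

datatype side = Lft | Rgt

definition qverts :: "'d cmap \<Rightarrow> ('d \<times> side) set" where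
  "qverts G = darts G \<times> UNIV"

text \<open>
  The face corners of \<open>G\<close>, hence the edges of the medial graph, hence the external edges, are
  indexed by darts: \<open>External d\<close> goes through the corner between \<open>d\<close> and \<open>rot d\<close>.
  \<open>ParEdge\<close> and \<open>ParDual\<close> are the internal edges parallel to the edge of \<open>d\<close> and to its dual. An
  edge carries a label because the quadri-tiling graph may have multiple edges (for instance
  \<open>External d\<close> and \<open>ParDual d\<close> if \<open>rot d = d\<close>).
\<close>

datatype 'd qedge = External 'd | ParEdge 'd | ParDual 'd

definition qedges :: "'d cmap \<Rightarrow> 'd qedge set" where
  "qedges G = External ` darts G \<union> ParEdge ` darts G \<union> ParDual ` darts G"

fun qends :: "'d cmap \<Rightarrow> 'd qedge \<Rightarrow> ('d \<times> side) set" where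
  "qends G (External d) = {(d, Lft), (rot G d, Rgt)}"
| "qends G (ParEdge d) = {(d, Lft), (opp G d, Rgt)}"
| "qends G (ParDual d) = {(d, Lft), (d, Rgt)}"

fun qweight :: "'d cmap \<Rightarrow> ('d set \<Rightarrow> real) \<Rightarrow> 'd qedge \<Rightarrow> real" where
  "qweight G J (External d) = 1"
| "qweight G J (ParEdge d) =
     (let e = edge_at G d in 2 * exp (- 2 * J e) / (1 + exp (- 4 * J e)))"
| "qweight G J (ParDual d) =
     (let e = edge_at G d in (1 - exp (- 4 * J e)) / (1 + exp (- 4 * J e)))"

definition dimers :: "'d cmap \<Rightarrow> 'd qedge set set" where
  "dimers G = {M. M \<subseteq> qedges G \<and> (\<forall>x\<in>qverts G. \<exists>!q. q \<in> M \<and> x \<in> qends G q)}"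

definition dimer_weight :: "'d cmap \<Rightarrow> ('d set \<Rightarrow> real) \<Rightarrow> 'd qedge set \<Rightarrow> real" where
  "dimer_weight G J M = (\<Prod>q\<in>M. qweight G J q)"

text \<open>
  The sectors around the medial vertex of \<open>e\<close> that contain a medial edge of the configuration
  induced by \<open>M\<close>. A medial loop occupies two sectors.
\<close>

definition present_sectors :: "'d cmap \<Rightarrow> 'd qedge set \<Rightarrow> 'd set \<Rightarrow> ('d \<times> side) set" where
  "present_sectors G M e = {x \<in> e \<times> UNIV. \<exists>c. External c \<in> M \<and> x \<in> qends G (External c)}"

text \<open>
  The edge \<open>e\<close> separates two present sectors from two absent ones iff the present
  sectors are exactly the two on the left of one of its two orientations.
\<close>

definition Poly1 :: "'d cmap \<Rightarrow> 'd qedge set \<Rightarrow> 'd set set" where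
  "Poly1 G M = {e\<in>edges G. \<exists>d\<in>e. present_sectors G M e = {(d, Lft), (opp G d, Rgt)}}"

definition dimers0 :: "'d cmap \<Rightarrow> 'd qedge set set" where
  "dimers0 G = {M\<in>dimers G. Poly1 G M \<in> polygons_of_class G (zero_class G)}"

definition Z0_quadri :: "'d cmap \<Rightarrow> ('d set \<Rightarrow> real) \<Rightarrow> real" where
  "Z0_quadri G J = (\<Sum>M\<in>dimers0 G. dimer_weight G J M)"

definition quadri0_measure :: "'d cmap \<Rightarrow> ('d set \<Rightarrow> real) \<Rightarrow> 'd qedge set measure" where
  "quadri0_measure G J =
     point_measure (dimers0 G) (\<lambda>M. ennreal (dimer_weight G J M / Z0_quadri G J))"

end

theory Submission
  imports Defs
begin

text \<open>
  Once the value \<open>P\<close> of the XOR polygon or of the first polygon is prescribed, both models reduce to the same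
  sum over spins \<open>\<tau>\<close> on the vertices of \<open>G\<close>. Fix a polygon configuration \<open>P\<close> of zero class, and let
  \<open>a\<^sub>e\<close> and \<open>b\<^sub>e\<close> be the weights of the internal edges parallel to \<open>e\<close> and to its dual. Let \<open>T(P)\<close> be the sum, over the spin configurations \<open>\<tau>\<close> that are constant along
  the edges of \<open>P\<close>, of the product of \<open>a\<^sub>e\<close> over \<open>e \<in> P\<close> and of \<open>b\<^sub>e\<close> over the edges \<open>e\<close> whose endpoints
  have different spins.

  Double Ising side. By the low temperature expansion, the configurations are the pairs \<open>(R, B)\<close> of
  homologous polygon configurations, with a weight proportional to \<open>x(R) x(B)\<close>, where \<open>x\<close> is the product
  of \<open>exp (- 2 J)\<close>, and the XOR polygon is the symmetric difference of \<open>R\<close> and \<open>B\<close>. When it is prescribed to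
  be \<open>P\<close>, the configuration \<open>R\<close> is an arbitrary polygon configuration of \<open>G\<close> and determines \<open>B\<close>. The
  constraint of even degrees on \<open>R\<close> is the average over \<open>\<tau>\<close> of the product of \<open>\<tau>\<^sub>u \<tau>\<^sub>v\<close> over the edges \<open>uv\<close>
  of \<open>R\<close>. After this substitution the sum over \<open>R\<close> factorizes over the edges, with the factor
  \<open>exp (- 2 J) (1 + \<tau>\<^sub>u \<tau>\<^sub>v)\<close> for \<open>uv \<in> P\<close> and \<open>1 + exp (- 4 J) \<tau>\<^sub>u \<tau>\<^sub>v\<close> for \<open>uv \<notin> P\<close>. Divided by
  \<open>1 + exp (- 4 J)\<close> these factors are \<open>a\<^sub>e\<close> or \<open>0\<close>, and \<open>1\<close> or \<open>b\<^sub>e\<close> (\<open>edge_sum_by_spin\<close>). Hence the weight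
  of the event that XOR is \<open>P\<close> is \<open>T(P)\<close> times an explicit constant (\<open>sum_weight_xor_eq\<close>), in which the
  genus enters through Euler's formula.

  Dimer side. Given the external edges of a dimer configuration, the quadrangles are matched
  independently (\<open>sum_dimers_factorizes\<close>), and the identity \<open>a\<^sub>e\<^sup>2 + b\<^sub>e\<^sup>2 = 1\<close> makes a quadrangle with no
  external edge, which has two matchings, weigh as much as one with four (\<open>quadrangle_sum\<close>). A set of
  external edges is a set of face corners. Its first polygon is \<open>P\<close> exactly if the presence of corners
  changes across the edges of \<open>P\<close> and only there when one turns around a vertex, and the corners at the two
  ends of each edge of \<open>P\<close> on a given side of it are both present or both absent. If \<open>P\<close>
  is the boundary of a set \<open>S\<close> of faces, the corners in the faces of \<open>S\<close> form such a set, and any other one is obtained by exchanging presence and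
  absence around the vertices where \<open>\<tau> = -1\<close>, for a unique \<open>\<tau>\<close> that is constant along the edges of \<open>P\<close>
  (\<open>external_config_in\<close>, \<open>external_config_surj\<close>). So the dimer configurations with first polygon \<open>P\<close> have
  total weight \<open>T(P)\<close> (\<open>sum_dimers_Poly1\<close>).

  As \<open>P\<close> ranges over all configurations of zero class, the two partition functions are thus proportional,
  and so are their restrictions to each \<open>P\<close>, with the same constant.
\<close>

section \<open>Darts, edges, vertices and faces\<close>

lemma permutes_orbit_facts:
  assumes "p permutes A" "finite A"
  shows "d \<in> orbit p d" "d' \<in> orbit p d \<Longrightarrow> orbit p d' = orbit p d"
    "d \<in> A \<Longrightarrow> orbit p d \<subseteq> A"
proof -
  have "permutation p"
    using assms by (auto intro: permutes_imp_permutation)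
  then show "d \<in> orbit p d"
    by (rule permutation_self_in_orbit)
  show "d' \<in> orbit p d \<Longrightarrow> orbit p d' = orbit p d"
    using \<open>permutation p\<close> by (rule orbit_cyclic_eq3[OF cyclic_on_orbit'])
  show "d \<in> A \<Longrightarrow> orbit p d \<subseteq> A"
    using assms(1) by (rule permutes_orbit_subset)
qed

lemma even_card_sym_diff:
  assumes "finite A" "finite B"
  shows "even (card (sym_diff A B)) \<longleftrightarrow> (even (card A) \<longleftrightarrow> even (card B))"
proof -
  have "card (sym_diff A B) = card (A - B) + card (B - A)"
    using assms by (intro card_Un_disjoint) auto
  moreover have "card A = card (A - B) + card (A \<inter> B)" "card B = card (B - A) + card (A \<inter> B)"
    using assms card_Int_Diff[of A B] card_Int_Diff[of B A] by (simp_all add: Int_commute)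
  ultimately show ?thesis by (auto simp: even_add)
qed

lemma prod_if_mem:
  fixes h :: "'a \<Rightarrow> real"
  assumes "finite A" "R \<subseteq> A"
  shows "(\<Prod>e\<in>A. if e \<in> R then h e else 1) = (\<Prod>e\<in>R. h e)"
  using assms by (simp add: prod.inter_restrict[symmetric] Int_absorb1)

locale embedded_graph =
  fixes G :: "'d cmap"
  assumes cellular: "cellular_map G"
begin

abbreviation left_face :: "'d \<Rightarrow> 'd set" where
  "left_face d \<equiv> vertex_at (dual G) d"

lemma finite_darts [simp]: "finite (darts G)"
  and darts_nonempty: "darts G \<noteq> {}"
  and rot_permutes: "rot G permutes darts G"
  and opp_permutes: "opp G permutes darts G"
  and opp_opp [simp]: "d \<in> darts G \<Longrightarrow> opp G (opp G d) = d"
  and opp_neq [simp]: "d \<in> darts G \<Longrightarrow> opp G d \<noteq> d"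
  using cellular by (auto simp: cellular_map_def)

lemma rot_in_darts [simp]: "rot G d \<in> darts G \<longleftrightarrow> d \<in> darts G"
  and opp_in_darts [simp]: "opp G d \<in> darts G \<longleftrightarrow> d \<in> darts G"
  and inv_rot_in_darts [simp]: "inv (rot G) d \<in> darts G \<longleftrightarrow> d \<in> darts G"
  using rot_permutes opp_permutes permutes_inv[OF rot_permutes]
  by (simp_all add: permutes_in_image)

lemma rot_inv_rot [simp]: "rot G (inv (rot G) d) = d"
  and inv_rot_rot [simp]: "inv (rot G) (rot G d) = d"
  using permutes_inverses[OF rot_permutes] by auto

lemma opp_neq' [simp]: "d \<in> darts G \<Longrightarrow> d \<noteq> opp G d"
  using opp_neq by metis

lemma darts_dual [simp]: "darts (dual G) = darts G"
  and opp_dual [simp]: "opp (dual G) = opp G"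
  and rot_dual: "rot (dual G) d = inv (rot G) (opp G d)"
  by (simp_all add: dual_def)

lemma edge_at_dual [simp]: "edge_at (dual G) = edge_at G"
  and edges_dual [simp]: "edges (dual G) = edges G"
  by (auto simp: edge_at_def edges_def fun_eq_iff)

lemma rot_dual_permutes: "rot (dual G) permutes darts G"
  unfolding dual_def by (simp add: permutes_compose permutes_inv rot_permutes opp_permutes)

text \<open>
  This is the form in which the connectedness of the surface is used.
\<close>

lemma invariant_imp_constant:
  assumes rot: "\<And>d. d \<in> darts G \<Longrightarrow> h (rot G d) = h d"
    and opp: "\<And>d. d \<in> darts G \<Longrightarrow> h (opp G d) = h d"
    and xy: "x \<in> darts G" "y \<in> darts G"
  shows "h x = h y"
proof -
  have "(x, y) \<in> ({(d, rot G d) | d. d \<in> darts G} \<union> {(d, opp G d) | d. d \<in> darts G})\<^sup>*"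
    using cellular xy by (auto simp: cellular_map_def)
  then show ?thesis
    by (induction rule: rtrancl_induct) (use rot opp in auto)
qed

lemma dart_in_vertex [simp]: "d \<in> vertex_at G d"
  and vertex_at_eqI: "d' \<in> vertex_at G d \<Longrightarrow> vertex_at G d' = vertex_at G d"
  and left_face_eqI: "d' \<in> left_face d \<Longrightarrow> left_face d' = left_face d"
  and vertex_subset_darts: "d \<in> darts G \<Longrightarrow> vertex_at G d \<subseteq> darts G"
  using permutes_orbit_facts[OF rot_permutes finite_darts]
    permutes_orbit_facts[OF rot_dual_permutes finite_darts]
  by (auto simp: vertex_at_def)

lemma vertex_at_rot [simp]: "vertex_at G (rot G d) = vertex_at G d"
  by (rule vertex_at_eqI) (simp add: vertex_at_def orbit.base)

lemma vertex_at_inv_rot [simp]: "vertex_at G (inv (rot G) d) = vertex_at G d"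
  using vertex_at_rot[of "inv (rot G) d"] by simp

text \<open>
  The edge of \<open>d\<close> separates two faces, and the one on its right is the left face of the dart just
  before \<open>d\<close> in counterclockwise order. This is what relates turning around a vertex to crossing edges.
\<close>

lemma left_face_inv_rot: "d \<in> darts G \<Longrightarrow> left_face (inv (rot G) d) = left_face (opp G d)"
  using left_face_eqI[of "rot (dual G) (opp G d)" "opp G d"]
    orbit.base[of "rot (dual G)" "opp G d"]
  by (simp add: vertex_at_def rot_dual)

lemma finite_verts [simp]: "finite (verts G)" "finite (verts (dual G))"
  and finite_edges [simp]: "finite (edges G)"
  by (simp_all add: verts_def edges_def)

lemma vertex_at_in_verts [simp]: "d \<in> darts G \<Longrightarrow> vertex_at G d \<in> verts G"
  and left_face_in_verts [simp]: "d \<in> darts G \<Longrightarrow> left_face d \<in> verts (dual G)"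
  and edge_at_in_edges [simp]: "d \<in> darts G \<Longrightarrow> edge_at G d \<in> edges G"
  by (auto simp: verts_def edges_def)

lemma verts_partition:
  "v \<in> verts G \<Longrightarrow> finite v" "v \<in> verts G \<Longrightarrow> v \<subseteq> darts G"
  "v \<in> verts G \<Longrightarrow> d \<in> v \<longleftrightarrow> d \<in> darts G \<and> vertex_at G d = v"
  using vertex_subset_darts
  by (auto simp: verts_def dest: vertex_at_eqI intro: finite_subset[OF _ finite_darts])

lemma edge_at_opp [simp]: "d \<in> darts G \<Longrightarrow> edge_at G (opp G d) = edge_at G d"
  by (auto simp: edge_at_def)

lemma edges_partition:
  "e \<in> edges G \<Longrightarrow> finite e"
  "e \<in> edges G \<Longrightarrow> d \<in> e \<longleftrightarrow> d \<in> darts G \<and> edge_at G d = e"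
  by (auto simp: edges_def edge_at_def)

lemma edge_cases:
  assumes "e \<in> edges G"
  obtains d where "d \<in> darts G" "e = edge_at G d"
  using assms by (auto simp: edges_def)

lemma prod_darts_by_edges:
  fixes h :: "'d \<Rightarrow> real"
  assumes "R \<subseteq> edges G"
  shows "(\<Prod>e\<in>R. \<Prod>d\<in>e. h d) = (\<Prod>d | d \<in> darts G \<and> edge_at G d \<in> R. h d)"
proof -
  have "finite R"
    using assms finite_edges by (rule finite_subset)
  have "(\<Prod>e\<in>R. \<Prod>d\<in>e. h d) = (\<Prod>e\<in>R. \<Prod>d | d \<in> {d \<in> darts G. edge_at G d \<in> R} \<and> edge_at G d = e. h d)"
    using assms by (intro prod.cong refl) (auto simp: edges_partition)
  also have "\<dots> = (\<Prod>d | d \<in> darts G \<and> edge_at G d \<in> R. h d)"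
    by (rule prod.group) (auto simp: \<open>finite R\<close>)
  finally show ?thesis .
qed

lemma prod_darts_by_vertices:
  fixes h :: "'d \<Rightarrow> real"
  shows "(\<Prod>d | d \<in> darts G \<and> Q d. h d) = (\<Prod>v\<in>verts G. \<Prod>d | d \<in> v \<and> Q d. h d)"
proof -
  have "(\<Prod>v\<in>verts G. \<Prod>d | d \<in> v \<and> Q d. h d) =
      (\<Prod>v\<in>verts G. \<Prod>d | d \<in> {d \<in> darts G. Q d} \<and> vertex_at G d = v. h d)"
    by (intro prod.cong refl) (auto simp: verts_partition)
  also have "\<dots> = (\<Prod>d | d \<in> darts G \<and> Q d. h d)"
    by (rule prod.group) auto
  finally show ?thesis by simp
qed

section \<open>Spins and homology\<close>

lemma edge_spin_edge_at:
  assumes "d \<in> darts G"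
  shows "edge_spin G \<sigma> (edge_at G d) = \<sigma> (vertex_at G d) * \<sigma> (vertex_at G (opp G d))"
    "edge_spin (dual G) \<sigma> (edge_at G d) = \<sigma> (left_face d) * \<sigma> (left_face (opp G d))"
  using assms by (simp_all add: edge_spin_def edge_at_def)

lemma spins_values:
  "\<tau> \<in> spins G \<Longrightarrow> d \<in> darts G \<Longrightarrow> \<tau> (vertex_at G d) = 1 \<or> \<tau> (vertex_at G d) = -1"
  "\<sigma> \<in> spins (dual G) \<Longrightarrow> d \<in> darts G \<Longrightarrow> \<sigma> (left_face d) = 1 \<or> \<sigma> (left_face d) = -1"
  by (auto simp: spins_def PiE_iff)

lemma edge_spin_values:
  "\<tau> \<in> spins G \<Longrightarrow> e \<in> edges G \<Longrightarrow> edge_spin G \<tau> e = 1 \<or> edge_spin G \<tau> e = -1"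
  "\<sigma> \<in> spins (dual G) \<Longrightarrow> e \<in> edges G \<Longrightarrow> edge_spin (dual G) \<sigma> e = 1 \<or> edge_spin (dual G) \<sigma> e = -1"
proof -
  show "edge_spin G \<tau> e = 1 \<or> edge_spin G \<tau> e = -1" if "\<tau> \<in> spins G" "e \<in> edges G"
  proof -
    obtain d where d: "d \<in> darts G" "e = edge_at G d" using \<open>e \<in> edges G\<close> by (rule edge_cases)
    show ?thesis
      using spins_values(1)[OF that(1), of d] spins_values(1)[OF that(1), of "opp G d"] d
      by (auto simp: edge_spin_edge_at)
  qed
  show "edge_spin (dual G) \<sigma> e = 1 \<or> edge_spin (dual G) \<sigma> e = -1"
    if "\<sigma> \<in> spins (dual G)" "e \<in> edges G"
  proof -
    obtain d where d: "d \<in> darts G" "e = edge_at G d" using \<open>e \<in> edges G\<close> by (rule edge_cases)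
    show ?thesis
      using spins_values(2)[OF that(1), of d] spins_values(2)[OF that(1), of "opp G d"] d
      by (auto simp: edge_spin_edge_at)
  qed
qed

lemma finite_spins [simp]: "finite (spins G)" "finite (spins (dual G))"
  by (simp_all add: spins_def finite_PiE)

lemma polygonsD: "P \<in> polygons G \<Longrightarrow> P \<subseteq> edges G"
  by (simp add: polygons_def)

lemma finite_polygons [simp]: "finite (polygons G)"
  by (rule finite_subset[of _ "Pow (edges G)"]) (auto simp: polygons_def)

lemma face_boundary_edge_at:
  assumes "d \<in> darts G"
  shows "edge_at G d \<in> face_boundary G S \<longleftrightarrow> (left_face d \<in> S) \<noteq> (left_face (opp G d) \<in> S)"
proof -
  have "{d' \<in> edge_at G d. left_face d' \<in> S} =
      (if left_face d \<in> S then {d} else {}) \<union> (if left_face (opp G d) \<in> S then {opp G d} else {})"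
    by (auto simp: edge_at_def)
  then show ?thesis
    using assms by (auto simp: face_boundary_def)
qed

lemma face_boundary_subset: "face_boundary G S \<subseteq> edges G"
  by (auto simp: face_boundary_def)

lemma polygons_sym_diff:
  assumes "P \<in> polygons G" "Q \<in> polygons G"
  shows "sym_diff P Q \<in> polygons G"
proof -
  have "even (card {d \<in> v. edge_at G d \<in> sym_diff P Q})" if "v \<in> verts G" for v
  proof -
    have "{d \<in> v. edge_at G d \<in> sym_diff P Q} =
        sym_diff {d \<in> v. edge_at G d \<in> P} {d \<in> v. edge_at G d \<in> Q}"
      by auto
    then show ?thesis
      using assms that even_card_sym_diff[of "{d \<in> v. edge_at G d \<in> P}" "{d \<in> v. edge_at G d \<in> Q}"]
      by (simp add: polygons_def verts_partition)
  qed
  then show ?thesis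
    using assms by (auto simp: polygons_def)
qed

text \<open>
  The edge of a dart at \<open>v\<close> lies in the boundary iff exactly one of the faces just before and just after
  the dart, in the order around \<open>v\<close>, lies in \<open>S\<close>. The darts preceded by a face of \<open>S\<close> are the images under
  the rotation of those followed by one, so there are equally many of both kinds.
\<close>

lemma face_boundary_polygon: "face_boundary G S \<in> polygons G"
proof -
  have "even (card {d \<in> v. edge_at G d \<in> face_boundary G S})" if v: "v \<in> verts G" for v
  proof -
    let ?A = "{d \<in> v. left_face d \<in> S}" and ?B = "{d \<in> v. left_face (inv (rot G) d) \<in> S}"
    have "{d \<in> v. edge_at G d \<in> face_boundary G S} = sym_diff ?A ?B"
      using v by (auto simp: verts_partition face_boundary_edge_at left_face_inv_rot)
    moreover have "bij_betw (rot G) ?A ?B"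
      using v by (intro bij_betw_byWitness[where f' = "inv (rot G)"]) (auto simp: verts_partition)
    then have "card ?A = card ?B"
      by (rule bij_betw_same_card)
    ultimately show ?thesis
      using v even_card_sym_diff[of ?A ?B] by (simp add: verts_partition)
  qed
  then show ?thesis
    by (simp add: polygons_def face_boundary_subset)
qed

lemma face_boundary_sym_diff:
  "face_boundary G (sym_diff S T) = sym_diff (face_boundary G S) (face_boundary G T)"
proof (rule set_eqI)
  fix e
  show "e \<in> face_boundary G (sym_diff S T) \<longleftrightarrow> e \<in> sym_diff (face_boundary G S) (face_boundary G T)"
  proof (cases "e \<in> edges G")
    case True
    then show ?thesis
      by (auto elim!: edge_cases simp: face_boundary_edge_at)
  qed (use face_boundary_subset in auto)
qed

lemma homologous_iff:
  "(P, Q) \<in> homologous G \<longleftrightarrow> P \<in> polygons G \<and> Q \<in> polygons G \<and>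
    (\<exists>S \<subseteq> verts (dual G). sym_diff P Q = face_boundary G S)"
  by (simp add: homologous_def)

lemma equiv_homologous: "equiv (polygons G) (homologous G)"
proof (rule equivI)
  show "refl_on (polygons G) (homologous G)"
    by (rule refl_onI) (auto simp: homologous_iff face_boundary_def intro!: exI[of _ "{}"])
  show "homologous G \<subseteq> polygons G \<times> polygons G"
    by (auto simp: homologous_def)
  show "sym (homologous G)"
    by (rule symI) (auto simp: homologous_iff Un_commute)
  show "trans (homologous G)"
  proof (rule transI)
    fix P Q R assume "(P, Q) \<in> homologous G" "(Q, R) \<in> homologous G"
    then obtain S T where *: "P \<in> polygons G" "R \<in> polygons G" 
        "S \<subseteq> verts (dual G)" "T \<subseteq> verts (dual G)"
        "sym_diff P Q = face_boundary G S" "sym_diff Q R = face_boundary G T"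
      by (auto simp: homologous_iff)
    have "sym_diff P R = face_boundary G (sym_diff S T)"
      unfolding face_boundary_sym_diff *(5,6)[symmetric] by blast
    moreover have "sym_diff S T \<subseteq> verts (dual G)"
      using *(3,4) by auto
    ultimately show "(P, R) \<in> homologous G"
      using *(1,2) unfolding homologous_iff by (intro conjI exI[of _ "sym_diff S T"])
  qed
qed

lemma hclass_eq_iff:
  "P \<in> polygons G \<Longrightarrow> Q \<in> polygons G \<Longrightarrow> hclass G P = hclass G Q \<longleftrightarrow> (P, Q) \<in> homologous G"
  by (simp add: hclass_def eq_equiv_class_iff[OF equiv_homologous])

lemma hclass_in_H1 [simp]: "P \<in> polygons G \<Longrightarrow> hclass G P \<in> H1 G"
  by (simp add: hclass_def H1_def quotientI)

lemma empty_polygon [simp]: "{} \<in> polygons G"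
  by (simp add: polygons_def)

text \<open>
  Boundaries are polygons, so the condition of being a polygon disappears on the right.
\<close>

lemma zero_class_iff:
  "P \<in> polygons_of_class G (zero_class G) \<longleftrightarrow> (\<exists>S \<subseteq> verts (dual G). P = face_boundary G S)"
proof -
  have "P \<in> polygons_of_class G (zero_class G) \<longleftrightarrow> (P, {}) \<in> homologous G"
    using hclass_eq_iff[of P "{}"]
    by (auto simp: polygons_of_class_def zero_class_def homologous_iff)
  then show ?thesis
    by (auto simp: homologous_iff face_boundary_polygon)
qed

lemma polygons_of_class_subset: "polygons_of_class G \<epsilon> \<subseteq> polygons G"
  by (auto simp: polygons_of_class_def)

lemma finite_polygons_of_class [simp]: "finite (polygons_of_class G \<epsilon>)"
  using finite_subset[OF polygons_of_class_subset] by simp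

text \<open>
  Only equality of classes matters for a pair, so the double Ising configurations do not refer to
  the classes themselves.
\<close>

lemma dIsing_configs_eq: "dIsing_configs G = homologous G"
proof (intro set_eqI)
  fix w :: "'d set set \<times> 'd set set"
  obtain R B where w: "w = (R, B)" by (cases w)
  have "w \<in> dIsing_configs G \<longleftrightarrow> R \<in> polygons G \<and> B \<in> polygons G \<and> hclass G R = hclass G B"
    unfolding w dIsing_configs_def polygons_of_class_def by auto
  also have "\<dots> \<longleftrightarrow> w \<in> homologous G"
    unfolding w using hclass_eq_iff[of R B] by (auto simp: homologous_iff)
  finally show "w \<in> dIsing_configs G \<longleftrightarrow> w \<in> homologous G" .
qed

section \<open>Low temperature expansion\<close>

lemma edge_in_spin_polygon:
  assumes "\<sigma> \<in> spins (dual G)" "e \<in> edges G"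
  shows "e \<in> spin_polygon G R \<sigma> \<longleftrightarrow> (e \<in> R) \<noteq> (edge_spin (dual G) \<sigma> e = -1)"
  using edge_spin_values(2)[OF assms] assms by (auto simp: spin_polygon_def twist_sign_def)

lemma spin_polygon_subset: "spin_polygon G R \<sigma> \<subseteq> edges G"
  by (auto simp: spin_polygon_def)

lemma edge_spin_face_boundary:
  assumes "\<sigma> \<in> spins (dual G)" "e \<in> edges G"
  shows "e \<in> face_boundary G {f \<in> verts (dual G). \<sigma> f = -1} \<longleftrightarrow> edge_spin (dual G) \<sigma> e = -1"
proof -
  obtain d where d: "d \<in> darts G" "e = edge_at G d"
    using \<open>e \<in> edges G\<close> by (rule edge_cases)
  show ?thesis
    using spins_values(2)[OF assms(1), of d] spins_values(2)[OF assms(1), of "opp G d"] d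
    by (auto simp: edge_spin_edge_at face_boundary_edge_at)
qed

text \<open>
  The edges at which the spins disagree separate the faces of spin \<open>-1\<close> from the others, and the
  twist exchanges agreement and disagreement on \<open>R\<close>.
\<close>

lemma spin_polygon_eq:
  assumes "\<sigma> \<in> spins (dual G)" "R \<subseteq> edges G"
  shows "spin_polygon G R \<sigma> = sym_diff R (face_boundary G {f \<in> verts (dual G). \<sigma> f = -1})"
proof (rule set_eqI)
  fix e
  show "e \<in> spin_polygon G R \<sigma> \<longleftrightarrow>
      e \<in> sym_diff R (face_boundary G {f \<in> verts (dual G). \<sigma> f = -1})"
  proof (cases "e \<in> edges G")
    case True
    then show ?thesis
      by (simp add: edge_in_spin_polygon edge_spin_face_boundary assms) blast
  next
    case False
    then show ?thesis
      using assms(2) face_boundary_subset spin_polygon_subset by blast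
  qed
qed

lemma spin_polygon_in_class:
  assumes "R \<in> polygons_of_class G \<epsilon>" "\<sigma> \<in> spins (dual G)"
  shows "spin_polygon G R \<sigma> \<in> polygons_of_class G \<epsilon>"
proof -
  let ?S = "{f \<in> verts (dual G). \<sigma> f = -1}"
  have R: "R \<in> polygons G" "hclass G R = \<epsilon>"
    using assms by (auto simp: polygons_of_class_def)
  have eq: "spin_polygon G R \<sigma> = sym_diff R (face_boundary G ?S)"
    using spin_polygon_eq[OF assms(2) polygonsD[OF R(1)]] .
  have *: "spin_polygon G R \<sigma> \<in> polygons G"
    unfolding eq by (intro polygons_sym_diff R face_boundary_polygon)
  moreover have "sym_diff (spin_polygon G R \<sigma>) R = face_boundary G ?S"
    unfolding eq by blast
  then have "(spin_polygon G R \<sigma>, R) \<in> homologous G"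
    using * R(1) unfolding homologous_iff by (intro conjI exI[of _ ?S]) auto
  ultimately show ?thesis
    using R hclass_eq_iff by (auto simp: polygons_of_class_def)
qed

lemma spin_polygon_surj:
  assumes "R \<in> polygons_of_class G \<epsilon>" "P \<in> polygons_of_class G \<epsilon>"
  shows "\<exists>\<sigma>\<in>spins (dual G). spin_polygon G R \<sigma> = P"
proof -
  have RP: "R \<in> polygons G" "P \<in> polygons G" "(R, P) \<in> homologous G"
    using assms hclass_eq_iff by (auto simp: polygons_of_class_def)
  then obtain S where S: "S \<subseteq> verts (dual G)" "sym_diff R P = face_boundary G S"
    by (auto simp: homologous_iff)
  define \<sigma> where "\<sigma> = (\<lambda>f\<in>verts (dual G). if f \<in> S then -1 else 1 :: real)"
  have \<sigma>: "\<sigma> \<in> spins (dual G)"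
    by (auto simp: \<sigma>_def spins_def)
  have "{f \<in> verts (dual G). \<sigma> f = -1} = S"
    using S(1) by (auto simp: \<sigma>_def)
  then have "spin_polygon G R \<sigma> = sym_diff R (sym_diff R P)"
    using spin_polygon_eq[OF \<sigma> polygonsD[OF RP(1)]] S(2) by simp
  also have "\<dots> = P" by blast
  finally show ?thesis using \<sigma> by blast
qed

text \<open>
  Since the surface is connected, two spin configurations with the same edge spins differ by a
  global sign: their product does not change when an edge is crossed, and any face can be reached
  from any other by crossing edges.
\<close>

lemma same_edge_spins:
  assumes \<sigma>: "\<sigma> \<in> spins (dual G)" and \<sigma>': "\<sigma>' \<in> spins (dual G)"
    and eq: "\<And>e. e \<in> edges G \<Longrightarrow> edge_spin (dual G) \<sigma> e = edge_spin (dual G) \<sigma>' e"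
  shows "\<sigma>' = \<sigma> \<or> \<sigma>' = (\<lambda>f\<in>verts (dual G). - \<sigma> f)"
proof -
  define h where "h d = \<sigma> (left_face d) * \<sigma>' (left_face d)" for d
  have opp: "h (opp G d) = h d" if d: "d \<in> darts G" for d
    using eq[of "edge_at G d"] d spins_values(2)[OF \<sigma>, of d] spins_values(2)[OF \<sigma>, of "opp G d"]
      spins_values(2)[OF \<sigma>', of d] spins_values(2)[OF \<sigma>', of "opp G d"]
    by (auto simp: h_def edge_spin_edge_at)
  have rot: "h (rot G d) = h d" if d: "d \<in> darts G" for d
    using opp[of "rot G d"] left_face_inv_rot[of "rot G d"] d by (simp add: h_def)
  obtain d0 where d0: "d0 \<in> darts G"
    using darts_nonempty by blast
  have h: "h d = h d0" if "d \<in> darts G" for d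
    using invariant_imp_constant[of h d d0] rot opp that d0 by blast
  have *: "\<sigma>' (left_face d) = h d0 * \<sigma> (left_face d)" if d: "d \<in> darts G" for d
    using h[OF d] spins_values(2)[OF \<sigma>, of d] d by (auto simp: h_def)
  have "h d0 = 1 \<or> h d0 = -1"
    using spins_values(2)[OF \<sigma> d0] spins_values(2)[OF \<sigma>' d0] by (auto simp: h_def)
  then show ?thesis
  proof
    assume "h d0 = 1"
    then have "\<sigma>' = \<sigma>"
      using \<sigma> \<sigma>' * unfolding spins_def by (intro PiE_ext) (auto simp: verts_def)
    then show ?thesis ..
  next
    assume "h d0 = -1"
    moreover have "(\<lambda>f\<in>verts (dual G). - \<sigma> f) \<in> spins (dual G)"
      using \<sigma> by (auto simp: spins_def PiE_iff)
    ultimately have "\<sigma>' = (\<lambda>f\<in>verts (dual G). - \<sigma> f)"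
      using \<sigma>' * unfolding spins_def by (intro PiE_ext) (auto simp: verts_def)
    then show ?thesis ..
  qed
qed

text \<open>
  A configuration and its opposite induce the same polygons; there are two of them because the
  surface has at least one face.
\<close>

lemma card_spin_polygon_fibre:
  assumes "R \<in> polygons_of_class G \<epsilon>" "P \<in> polygons_of_class G \<epsilon>"
  shows "card {\<sigma> \<in> spins (dual G). spin_polygon G R \<sigma> = P} = 2"
proof -
  obtain \<sigma> where \<sigma>: "\<sigma> \<in> spins (dual G)" "spin_polygon G R \<sigma> = P"
    using spin_polygon_surj[OF assms] by blast
  define \<sigma>' where "\<sigma>' = (\<lambda>f\<in>verts (dual G). - \<sigma> f)"
  have \<sigma>': "\<sigma>' \<in> spins (dual G)"
    using \<sigma> by (auto simp: spins_def PiE_iff \<sigma>'_def)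
  have edge: "edge_spin (dual G) \<sigma>' e = edge_spin (dual G) \<sigma> e" if "e \<in> edges G" for e
    using that by (auto elim!: edge_cases simp: edge_spin_edge_at \<sigma>'_def)
  have "\<sigma> \<noteq> \<sigma>'"
  proof -
    obtain d where "d \<in> darts G" using darts_nonempty by blast
    then have "\<sigma> (left_face d) \<noteq> \<sigma>' (left_face d)"
      using spins_values(2)[OF \<sigma>(1), of d] by (auto simp: \<sigma>'_def)
    then show ?thesis by auto
  qed
  moreover have "{\<sigma> \<in> spins (dual G). spin_polygon G R \<sigma> = P} = {\<sigma>, \<sigma>'}"
  proof (intro equalityI subsetI)
    fix \<rho> assume "\<rho> \<in> {\<sigma> \<in> spins (dual G). spin_polygon G R \<sigma> = P}"
    then have \<rho>: "\<rho> \<in> spins (dual G)" "spin_polygon G R \<rho> = P" by auto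
    have "edge_spin (dual G) \<sigma> e = edge_spin (dual G) \<rho> e" if e: "e \<in> edges G" for e
    proof -
      have "edge_spin (dual G) \<sigma> e = -1 \<longleftrightarrow> edge_spin (dual G) \<rho> e = -1"
        using edge_in_spin_polygon[OF \<sigma>(1) e, of R] edge_in_spin_polygon[OF \<rho>(1) e, of R]
        unfolding \<sigma>(2) \<rho>(2) by blast
      then show ?thesis
        using edge_spin_values(2)[OF \<sigma>(1) e] edge_spin_values(2)[OF \<rho>(1) e] by metis
    qed
    then show "\<rho> \<in> {\<sigma>, \<sigma>'}"
      using same_edge_spins[OF \<sigma>(1) \<rho>(1)] by (auto simp: \<sigma>'_def)
  next
    have "spin_polygon G R \<sigma>' = spin_polygon G R \<sigma>"
      using edge by (auto simp: spin_polygon_def)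
    then show "\<rho> \<in> {\<sigma> \<in> spins (dual G). spin_polygon G R \<sigma> = P}" if "\<rho> \<in> {\<sigma>, \<sigma>'}" for \<rho>
      using that \<sigma> \<sigma>' by auto
  qed
  ultimately show ?thesis by simp
qed

lemma exp_energy:
  assumes "\<sigma> \<in> spins (dual G)"
  shows "exp (\<Sum>e\<in>edges G. twist_sign R e * J e * edge_spin (dual G) \<sigma> e) =
    (\<Prod>e\<in>edges G. exp (J e)) * (\<Prod>e\<in>spin_polygon G R \<sigma>. exp (- 2 * J e))"
proof -
  have "exp (\<Sum>e\<in>edges G. twist_sign R e * J e * edge_spin (dual G) \<sigma> e) =
      (\<Prod>e\<in>edges G. exp (J e) * (if e \<in> spin_polygon G R \<sigma> then exp (- 2 * J e) else 1))"
    unfolding exp_sum[OF finite_edges]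
  proof (intro prod.cong refl)
    fix e assume e: "e \<in> edges G"
    show "exp (twist_sign R e * J e * edge_spin (dual G) \<sigma> e) =
        exp (J e) * (if e \<in> spin_polygon G R \<sigma> then exp (- 2 * J e) else 1)"
      using edge_spin_values(2)[OF assms e] edge_in_spin_polygon[OF assms e, of R]
      by (auto simp: twist_sign_def simp flip: exp_add)
  qed
  also have "\<dots> = (\<Prod>e\<in>edges G. exp (J e)) *
      (\<Prod>e\<in>edges G. if e \<in> spin_polygon G R \<sigma> then exp (- 2 * J e) else 1)"
    by (rule prod.distrib)
  also have "(\<Prod>e\<in>edges G. if e \<in> spin_polygon G R \<sigma> then exp (- 2 * J e) else 1) =
      (\<Prod>e\<in>spin_polygon G R \<sigma>. exp (- 2 * J e))"
    by (rule prod_if_mem[OF finite_edges spin_polygon_subset])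
  finally show ?thesis .
qed

lemma Z_Ising_low_temperature:
  assumes "R \<in> polygons_of_class G \<epsilon>"
  shows "Z_Ising (dual G) R J =
    2 * (\<Prod>e\<in>edges G. exp (J e)) * (\<Sum>P\<in>polygons_of_class G \<epsilon>. \<Prod>e\<in>P. exp (- 2 * J e))"
proof -
  let ?w = "\<lambda>P. (\<Prod>e\<in>edges G. exp (J e)) * (\<Prod>e\<in>P. exp (- 2 * J e))"
  have "Z_Ising (dual G) R J = (\<Sum>\<sigma>\<in>spins (dual G). ?w (spin_polygon G R \<sigma>))"
    unfolding Z_Ising_def edges_dual by (rule sum.cong[OF refl exp_energy])
  also have "\<dots> = (\<Sum>P\<in>polygons_of_class G \<epsilon>.
      \<Sum>\<sigma> | \<sigma> \<in> spins (dual G) \<and> spin_polygon G R \<sigma> = P. ?w (spin_polygon G R \<sigma>))"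
    using spin_polygon_in_class[OF assms] by (intro sum.group[symmetric]) auto
  also have "\<dots> = (\<Sum>P\<in>polygons_of_class G \<epsilon>. 2 * ?w P)"
    using card_spin_polygon_fibre[OF assms] by (intro sum.cong refl) simp
  also have "\<dots> = 2 * (\<Prod>e\<in>edges G. exp (J e)) *
      (\<Sum>P\<in>polygons_of_class G \<epsilon>. \<Prod>e\<in>P. exp (- 2 * J e))"
    by (simp add: sum_distrib_left mult_ac)
  finally show ?thesis .
qed

lemma finite_H1 [simp]: "finite (H1 G)"
  unfolding H1_def quotient_def by simp

lemma finite_homologous [simp]: "finite (homologous G)"
  by (rule finite_subset[of _ "polygons G \<times> polygons G"]) (auto simp: homologous_iff)

lemma Z_dIsing_sum_weights:
  assumes rep: "\<And>\<epsilon>. \<epsilon> \<in> H1 G \<Longrightarrow> rep \<epsilon> \<in> polygons_of_class G \<epsilon>"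
  shows "Z_dIsing G rep J = (\<Sum>w\<in>homologous G. dIsing_weight G J w)"
proof -
  let ?C = "\<lambda>\<epsilon>. polygons_of_class G \<epsilon>"
  have "Z_dIsing G rep J = (\<Sum>\<epsilon>\<in>H1 G. \<Sum>w\<in>?C \<epsilon> \<times> ?C \<epsilon>. dIsing_weight G J w)"
    unfolding Z_dIsing_def
  proof (intro sum.cong refl)
    fix \<epsilon> assume "\<epsilon> \<in> H1 G"
    then have "(Z_Ising (dual G) (rep \<epsilon>) J)\<^sup>2 = (2 * (\<Prod>e\<in>edges G. exp (J e)))\<^sup>2 *
        ((\<Sum>P\<in>?C \<epsilon>. \<Prod>e\<in>P. exp (- 2 * J e)) * (\<Sum>P\<in>?C \<epsilon>. \<Prod>e\<in>P. exp (- 2 * J e)))"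
      using Z_Ising_low_temperature[OF rep] by (simp add: power2_eq_square)
    also have "(\<Sum>P\<in>?C \<epsilon>. \<Prod>e\<in>P. exp (- 2 * J e)) * (\<Sum>P\<in>?C \<epsilon>. \<Prod>e\<in>P. exp (- 2 * J e)) =
        (\<Sum>(R, B)\<in>?C \<epsilon> \<times> ?C \<epsilon>. (\<Prod>e\<in>R. exp (- 2 * J e)) * (\<Prod>e\<in>B. exp (- 2 * J e)))"
      unfolding sum_product sum.cartesian_product ..
    also have "(2 * (\<Prod>e\<in>edges G. exp (J e)))\<^sup>2 * \<dots> =
        (\<Sum>w\<in>?C \<epsilon> \<times> ?C \<epsilon>. dIsing_weight G J w)"
      unfolding sum_distrib_left dIsing_weight_def case_prod_unfold by (simp add: mult.assoc)
    finally show "(Z_Ising (dual G) (rep \<epsilon>) J)\<^sup>2 = (\<Sum>w\<in>?C \<epsilon> \<times> ?C \<epsilon>. dIsing_weight G J w)" .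
  qed
  also have "\<dots> = (\<Sum>w\<in>dIsing_configs G. dIsing_weight G J w)"
    unfolding dIsing_configs_def
    by (rule sum.UNION_disjoint[symmetric]) (auto simp: polygons_of_class_def)
  finally show ?thesis
    by (simp add: dIsing_configs_eq)
qed

text \<open>
  The spins of a homologous pair are read with the same representative, whose signs cancel in the
  product, so the XOR polygon is the symmetric difference.
\<close>

lemma xor_polygon_eq:
  assumes rep: "\<And>\<epsilon>. \<epsilon> \<in> H1 G \<Longrightarrow> rep \<epsilon> \<in> polygons_of_class G \<epsilon>"
    and RB: "(R, B) \<in> homologous G"
  shows "xor_polygon G rep (R, B) = sym_diff R B"
proof -
  define \<epsilon> where "\<epsilon> = hclass G R"
  have R: "R \<in> polygons G" "hclass G R = \<epsilon>" and B: "B \<in> polygons G" "hclass G B = \<epsilon>"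
    using RB hclass_eq_iff[of R B] by (auto simp: homologous_iff \<epsilon>_def)
  have spin: "spin_of G rep P \<in> spins (dual G) \<and> spin_polygon G (rep \<epsilon>) (spin_of G rep P) = P"
    if "P \<in> polygons G" "hclass G P = \<epsilon>" for P
  proof -
    have "\<epsilon> \<in> H1 G" "P \<in> polygons_of_class G \<epsilon>"
      using R that by (auto simp: \<epsilon>_def polygons_of_class_def)
    then have "\<exists>\<sigma>. \<sigma> \<in> spins (dual G) \<and> spin_polygon G (rep \<epsilon>) \<sigma> = P"
      using spin_polygon_surj[OF rep] by blast
    then show ?thesis
      unfolding spin_of_def that(2) by (rule someI_ex)
  qed
  define \<sigma> \<sigma>' where "\<sigma> = spin_of G rep R" and "\<sigma>' = spin_of G rep B"
  have \<sigma>: "\<sigma> \<in> spins (dual G)" "spin_polygon G (rep \<epsilon>) \<sigma> = R"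
    and \<sigma>': "\<sigma>' \<in> spins (dual G)" "spin_polygon G (rep \<epsilon>) \<sigma>' = B"
    using spin[OF R] spin[OF B] by (auto simp: \<sigma>_def \<sigma>'_def)
  have sub: "R \<subseteq> edges G" "B \<subseteq> edges G"
    using R(1) B(1) by (auto dest: polygonsD)
  have "edge_at G d \<in> xor_polygon G rep (R, B) \<longleftrightarrow> edge_at G d \<in> sym_diff R B"
    if d: "d \<in> darts G" for d
  proof -
    have "edge_at G d \<in> xor_polygon G rep (R, B) \<longleftrightarrow>
        \<sigma> (left_face d) * \<sigma>' (left_face d) \<noteq> \<sigma> (left_face (opp G d)) * \<sigma>' (left_face (opp G d))"
      using edge_at_in_edges[OF d]
      unfolding xor_polygon_def Let_def split_conv mem_Collect_eq \<sigma>_def \<sigma>'_def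
      by (simp add: edge_at_def)
    also have "\<dots> \<longleftrightarrow> (edge_spin (dual G) \<sigma> (edge_at G d) = -1) \<noteq>
        (edge_spin (dual G) \<sigma>' (edge_at G d) = -1)"
      using d spins_values(2)[OF \<sigma>(1), of d] spins_values(2)[OF \<sigma>(1), of "opp G d"]
        spins_values(2)[OF \<sigma>'(1), of d] spins_values(2)[OF \<sigma>'(1), of "opp G d"]
      by (auto simp: edge_spin_edge_at)
    also have "\<dots> \<longleftrightarrow> edge_at G d \<in> sym_diff R B"
      using edge_in_spin_polygon[OF \<sigma>(1), of "edge_at G d" "rep \<epsilon>"]
        edge_in_spin_polygon[OF \<sigma>'(1), of "edge_at G d" "rep \<epsilon>"] d \<sigma>(2) \<sigma>'(2)
      by auto
    finally show ?thesis .
  qed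
  then have "e \<in> xor_polygon G rep (R, B) \<longleftrightarrow> e \<in> sym_diff R B" if "e \<in> edges G" for e
    using edge_cases[OF that] by metis
  moreover have "xor_polygon G rep (R, B) \<subseteq> edges G"
    by (auto simp: xor_polygon_def Let_def)
  moreover have "sym_diff R B \<subseteq> edges G"
    using sub by blast
  ultimately show ?thesis
    by (meson subset_antisym subset_eq)
qed

text \<open>
  Adding a boundary does not change the homology class, so every polygon configuration \<open>R\<close> occurs as
  first component: the sum over homology classes disappears.
\<close>

lemma sum_weight_xor:
  assumes P: "P \<in> polygons_of_class G (zero_class G)"
  shows "(\<Sum>w | w \<in> homologous G \<and> (case w of (R, B) \<Rightarrow> sym_diff R B) = P. dIsing_weight G J w) =
    (\<Sum>R\<in>polygons G. dIsing_weight G J (R, sym_diff R P))"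
proof (rule sum.reindex_bij_witness[of _ "\<lambda>R. (R, sym_diff R P)" fst])
  fix R assume R: "R \<in> polygons G"
  obtain S where S: "S \<subseteq> verts (dual G)" "P = face_boundary G S"
    using P by (auto simp: zero_class_iff)
  have "sym_diff R P \<in> polygons G"
    using P R by (intro polygons_sym_diff) (auto simp: polygons_of_class_def)
  moreover have "sym_diff R (sym_diff R P) = P" by blast
  ultimately show "(R, sym_diff R P) \<in> {w. w \<in> homologous G \<and> (case w of (R, B) \<Rightarrow> sym_diff R B) = P}"
    using R S by (auto simp: homologous_iff)
next
  fix w assume "w \<in> {w. w \<in> homologous G \<and> (case w of (R, B) \<Rightarrow> sym_diff R B) = P}"
  then obtain R B where w: "w = (R, B)" "R \<in> polygons G" "P = sym_diff R B"
    by (auto simp: homologous_iff)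
  have "sym_diff R (sym_diff R B) = B" by blast
  then show "(fst w, sym_diff (fst w) P) = w" "fst w \<in> polygons G"
    "dIsing_weight G J (fst w, sym_diff (fst w) P) = dIsing_weight G J w"
    using w by simp_all
qed simp

end

section \<open>Fixing the XOR polygon\<close>

definition par_edge_weight :: "('d set \<Rightarrow> real) \<Rightarrow> 'd set \<Rightarrow> real" where
  "par_edge_weight J e = 2 * exp (- 2 * J e) / (1 + exp (- 4 * J e))"

definition par_dual_weight :: "('d set \<Rightarrow> real) \<Rightarrow> 'd set \<Rightarrow> real" where
  "par_dual_weight J e = (1 - exp (- 4 * J e)) / (1 + exp (- 4 * J e))"

text \<open>
  The two terms on the left correspond to an edge absent from and present in the red polygon; the
  first identity is for the edges of the XOR polygon, where exactly one colour is present, the second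
  for the other edges, where both colours agree.
\<close>

lemma edge_sum_by_spin:
  fixes s :: real
  assumes "s = 1 \<or> s = -1"
  shows "exp (- 2 * J e) + exp (- 2 * J e) * s =
      (1 + exp (- 4 * J e)) * (if s = 1 then par_edge_weight J e else 0)"
    and "1 + exp (- 2 * J e) * exp (- 2 * J e) * s =
      (1 + exp (- 4 * J e)) * (if s = 1 then 1 else par_dual_weight J e)"
proof -
  have "1 + exp (- 4 * J e) \<noteq> 0"
    using exp_gt_zero[of "- 4 * J e"] by linarith
  moreover have "exp (- 2 * J e) * exp (- 2 * J e) = exp (- 4 * J e)"
    by (simp flip: exp_add)
  ultimately show "exp (- 2 * J e) + exp (- 2 * J e) * s =
      (1 + exp (- 4 * J e)) * (if s = 1 then par_edge_weight J e else 0)"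
    "1 + exp (- 2 * J e) * exp (- 2 * J e) * s =
      (1 + exp (- 4 * J e)) * (if s = 1 then 1 else par_dual_weight J e)"
    using assms by (auto simp: par_edge_weight_def par_dual_weight_def)
qed

context embedded_graph
begin

text \<open>
  The zero factor suppresses the spin configurations that are not constant along the edges of \<open>P\<close>, so
  that sums can be taken over all of \<open>spins G\<close>.
\<close>

definition contour_weight :: "('d set \<Rightarrow> real) \<Rightarrow> 'd set set \<Rightarrow> ('d set \<Rightarrow> real) \<Rightarrow> real" where
  "contour_weight J P \<tau> = (\<Prod>e\<in>edges G.
     if e \<in> P then (if edge_spin G \<tau> e = 1 then par_edge_weight J e else 0)
     else if edge_spin G \<tau> e = 1 then 1 else par_dual_weight J e)"

text \<open>
  Detection of polygons by characters: collecting the factors by vertices, the spin at \<open>v\<close> appears as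
  many times as the degree of \<open>v\<close> in \<open>R\<close>, so summing over this spin gives \<open>2\<close> or \<open>0\<close> according to the parity.
\<close>

lemma sum_spins_prod_edge_spin:
  assumes "R \<subseteq> edges G"
  shows "(\<Sum>\<tau>\<in>spins G. \<Prod>e\<in>R. edge_spin G \<tau> e) = (if R \<in> polygons G then 2 ^ card (verts G) else 0)"
proof -
  define deg where "deg v = card {d \<in> v. edge_at G d \<in> R}" for v
  have "(\<Prod>e\<in>R. edge_spin G \<tau> e) = (\<Prod>v\<in>verts G. \<tau> v ^ deg v)" for \<tau> :: "'d set \<Rightarrow> real"
  proof -
    have "(\<Prod>e\<in>R. edge_spin G \<tau> e) = (\<Prod>v\<in>verts G. \<Prod>d | d \<in> v \<and> edge_at G d \<in> R. \<tau> (vertex_at G d))"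
      unfolding edge_spin_def prod_darts_by_edges[OF assms] by (rule prod_darts_by_vertices)
    also have "\<dots> = (\<Prod>v\<in>verts G. \<tau> v ^ deg v)"
    proof (intro prod.cong refl)
      fix v assume v: "v \<in> verts G"
      have "(\<Prod>d | d \<in> v \<and> edge_at G d \<in> R. \<tau> (vertex_at G d)) = (\<Prod>d | d \<in> v \<and> edge_at G d \<in> R. \<tau> v)"
        using v by (intro prod.cong refl) (simp add: verts_partition)
      then show "(\<Prod>d | d \<in> v \<and> edge_at G d \<in> R. \<tau> (vertex_at G d)) = \<tau> v ^ deg v"
        by (simp add: deg_def)
    qed
    finally show ?thesis .
  qed
  then have "(\<Sum>\<tau>\<in>spins G. \<Prod>e\<in>R. edge_spin G \<tau> e) = (\<Sum>\<tau>\<in>spins G. \<Prod>v\<in>verts G. \<tau> v ^ deg v)"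
    by simp
  also have "\<dots> = (\<Prod>v\<in>verts G. \<Sum>s\<in>{-1, 1}. s ^ deg v)"
    unfolding spins_def by (rule prod_sum_PiE[symmetric]) auto
  also have "\<dots> = (\<Prod>v\<in>verts G. if even (deg v) then 2 else 0)"
    by (intro prod.cong refl) simp
  also have "\<dots> = (if R \<in> polygons G then 2 ^ card (verts G) else 0)"
    using assms by (auto simp: polygons_def deg_def)
  finally show ?thesis .
qed

text \<open>
  Writing the constraint on \<open>R\<close> as a sum over spins lets \<open>R\<close> range over all sets of edges, and
  then the sum over \<open>R\<close> is the expansion of a product over edges.
\<close>

lemma sum_weight_polygons:
  assumes P: "P \<in> polygons G"
  shows "(\<Sum>R\<in>polygons G. dIsing_weight G J (R, sym_diff R P)) =
    (2 * (\<Prod>e\<in>edges G. exp (J e)))\<^sup>2 * (\<Prod>e\<in>edges G. 1 + exp (- 4 * J e)) / 2 ^ card (verts G) *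
    (\<Sum>\<tau>\<in>spins G. contour_weight J P \<tau>)"
proof -
  define x where "x e = exp (- 2 * J e)" for e
  define C where "C = (2 * (\<Prod>e\<in>edges G. exp (J e)))\<^sup>2"
  \<comment> \<open>The factor of an edge, \<open>b\<close> telling whether it lies in the red polygon \<open>R\<close>. The second
    part is the contribution of the blue polygon, the symmetric difference of \<open>R\<close> and \<open>P\<close>.\<close>
  define y where "y b e = (if b then x e else 1) * (if b \<noteq> (e \<in> P) then x e else 1)" for b e
  have weight: "dIsing_weight G J (R, sym_diff R P) = C * (\<Prod>e\<in>edges G. y (e \<in> R) e)"
    if R: "R \<subseteq> edges G" for R
  proof -
    have "dIsing_weight G J (R, sym_diff R P) = C * ((\<Prod>e\<in>R. x e) * (\<Prod>e\<in>sym_diff R P. x e))"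
      by (simp add: dIsing_weight_def C_def x_def mult.assoc)
    also have "(\<Prod>e\<in>sym_diff R P. x e) = (\<Prod>e\<in>edges G. if (e \<in> R) \<noteq> (e \<in> P) then x e else 1)"
      using R polygonsD[OF P] by (subst prod_if_mem[OF finite_edges, symmetric]) (auto intro!: prod.cong)
    also have "(\<Prod>e\<in>R. x e) = (\<Prod>e\<in>edges G. if e \<in> R then x e else 1)"
      using R by (simp add: prod_if_mem[OF finite_edges])
    finally show ?thesis
      by (simp add: y_def flip: prod.distrib)
  qed
  have transform: "(\<Sum>R\<in>Pow (edges G). (\<Prod>e\<in>edges G. y (e \<in> R) e) * (\<Prod>e\<in>R. edge_spin G \<tau> e)) =
      (\<Prod>e\<in>edges G. 1 + exp (- 4 * J e)) * contour_weight J P \<tau>"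
    if \<tau>: "\<tau> \<in> spins G" for \<tau>
  proof -
    let ?f = "\<lambda>e. y True e * edge_spin G \<tau> e"
    have "(\<Sum>R\<in>Pow (edges G). (\<Prod>e\<in>edges G. y (e \<in> R) e) * (\<Prod>e\<in>R. edge_spin G \<tau> e)) =
        (\<Sum>R\<in>Pow (edges G). prod ?f R * prod (y False) (edges G - R))"
    proof (intro sum.cong refl)
      fix R assume "R \<in> Pow (edges G)"
      then have R: "R \<subseteq> edges G" by simp
      have "(\<Prod>e\<in>edges G. y (e \<in> R) e) = (\<Prod>e\<in>edges G - R. y (e \<in> R) e) * (\<Prod>e\<in>R. y (e \<in> R) e)"
        by (rule prod.subset_diff[OF R finite_edges])
      also have "\<dots> = prod (y False) (edges G - R) * prod (y True) R"
        by (intro arg_cong2[where f = "(*)"] prod.cong) auto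
      finally show "(\<Prod>e\<in>edges G. y (e \<in> R) e) * (\<Prod>e\<in>R. edge_spin G \<tau> e) =
          prod ?f R * prod (y False) (edges G - R)"
        by (simp add: prod.distrib)
    qed
    also have "\<dots> = (\<Prod>e\<in>edges G. ?f e + y False e)"
      by (rule prod_add[symmetric]) simp
    also have "\<dots> = (\<Prod>e\<in>edges G. (1 + exp (- 4 * J e)) *
        (if e \<in> P then (if edge_spin G \<tau> e = 1 then par_edge_weight J e else 0)
         else if edge_spin G \<tau> e = 1 then 1 else par_dual_weight J e))"
    proof (intro prod.cong refl)
      fix e assume "e \<in> edges G"
      then have s: "edge_spin G \<tau> e = 1 \<or> edge_spin G \<tau> e = -1"
        by (rule edge_spin_values(1)[OF \<tau>])
      show "?f e + y False e = (1 + exp (- 4 * J e)) *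
          (if e \<in> P then (if edge_spin G \<tau> e = 1 then par_edge_weight J e else 0)
           else if edge_spin G \<tau> e = 1 then 1 else par_dual_weight J e)"
        using edge_sum_by_spin[OF s, of J e]
        by (cases "e \<in> P") (simp_all only: y_def x_def if_True if_False simp_thms mult_1 mult_1_right add.commute)
    qed
    finally show ?thesis
      by (simp add: prod.distrib contour_weight_def)
  qed
  have "(\<Sum>R\<in>polygons G. dIsing_weight G J (R, sym_diff R P)) =
      (\<Sum>R\<in>polygons G. C * (\<Prod>e\<in>edges G. y (e \<in> R) e))"
    using weight by (intro sum.cong refl) (auto dest: polygonsD)
  also have "\<dots> = (\<Sum>R\<in>Pow (edges G). if R \<in> polygons G then C * (\<Prod>e\<in>edges G. y (e \<in> R) e) else 0)"
    by (rule sum.mono_neutral_cong_left) (auto dest: polygonsD)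
  also have "\<dots> = (\<Sum>R\<in>Pow (edges G). \<Sum>\<tau>\<in>spins G. C / 2 ^ card (verts G) *
      ((\<Prod>e\<in>edges G. y (e \<in> R) e) * (\<Prod>e\<in>R. edge_spin G \<tau> e)))"
  proof (intro sum.cong refl)
    fix R assume "R \<in> Pow (edges G)"
    then show "(if R \<in> polygons G then C * (\<Prod>e\<in>edges G. y (e \<in> R) e) else 0) =
      (\<Sum>\<tau>\<in>spins G. C / 2 ^ card (verts G) *
        ((\<Prod>e\<in>edges G. y (e \<in> R) e) * (\<Prod>e\<in>R. edge_spin G \<tau> e)))"
      unfolding sum_distrib_left[symmetric] by (simp add: sum_spins_prod_edge_spin)
  qed
  also have "\<dots> = (\<Sum>\<tau>\<in>spins G. C / 2 ^ card (verts G) * (\<Sum>R\<in>Pow (edges G).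
      (\<Prod>e\<in>edges G. y (e \<in> R) e) * (\<Prod>e\<in>R. edge_spin G \<tau> e)))"
    unfolding sum_distrib_left by (rule sum.swap)
  also have "\<dots> = (\<Sum>\<tau>\<in>spins G. C / 2 ^ card (verts G) *
      ((\<Prod>e\<in>edges G. 1 + exp (- 4 * J e)) * contour_weight J P \<tau>))"
    by (intro sum.cong refl) (simp only: transform)
  finally show ?thesis
    unfolding C_def sum_distrib_left[symmetric] by (simp add: mult_ac)
qed

text \<open>
  The genus enters here only, through Euler's formula
  \<open>card (verts (dual G)) + 2 * g + card (verts G) = card (edges G) + 2\<close>.
\<close>

lemma normalization_constant:
  fixes J :: "'d set \<Rightarrow> real"
  assumes "euler_char G = 2 - 2 * int g"
  shows "(2 * (\<Prod>e\<in>edges G. exp (J e)))\<^sup>2 * (\<Prod>e\<in>edges G. 1 + exp (- 4 * J e)) / 2 ^ card (verts G) =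
    2 ^ (card (verts (dual G)) + 2 * g) * (\<Prod>e\<in>edges G. cosh (2 * J e))"
proof -
  have "exp (J e) ^ 2 * (1 + exp (- 4 * J e)) = 2 * cosh (2 * J e)" for e
    by (simp add: cosh_def power2_eq_square distrib_left flip: exp_add)
  then have "(\<Prod>e\<in>edges G. (exp (J e))\<^sup>2 * (1 + exp (- 4 * J e))) =
      (\<Prod>e\<in>edges G. 2 * cosh (2 * J e))"
    by simp
  then have "(\<Prod>e\<in>edges G. exp (J e))\<^sup>2 * (\<Prod>e\<in>edges G. 1 + exp (- 4 * J e)) =
      2 ^ card (edges G) * (\<Prod>e\<in>edges G. cosh (2 * J e))"
    by (simp add: prod.distrib prod_power_distrib)
  moreover have "card (verts (dual G)) + 2 * g + card (verts G) = card (edges G) + 2"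
    using assms unfolding euler_char_def by linarith
  then have "(2::real) ^ (card (verts (dual G)) + 2 * g) * 2 ^ card (verts G) = 4 * 2 ^ card (edges G)"
    by (simp flip: power_add)
  ultimately show ?thesis
    by (simp add: power_mult_distrib field_simps)
qed

lemma sum_weight_xor_eq:
  assumes "euler_char G = 2 - 2 * int g" and P: "P \<in> polygons_of_class G (zero_class G)"
  shows "(\<Sum>w | w \<in> homologous G \<and> (case w of (R, B) \<Rightarrow> sym_diff R B) = P. dIsing_weight G J w) =
    2 ^ (card (verts (dual G)) + 2 * g) * (\<Prod>e\<in>edges G. cosh (2 * J e)) *
    (\<Sum>\<tau>\<in>spins G. contour_weight J P \<tau>)"
proof -
  have "P \<in> polygons G"
    using P by (simp add: polygons_of_class_def)
  then show ?thesis
    unfolding sum_weight_xor[OF P] sum_weight_polygons[OF \<open>P \<in> polygons G\<close>]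
      normalization_constant[OF assms(1)] by simp
qed

end

section \<open>Dimer configurations\<close>

definition exactly_one :: "bool \<Rightarrow> bool \<Rightarrow> bool \<Rightarrow> bool" where
  "exactly_one a b c \<longleftrightarrow> (a \<and> \<not> b \<and> \<not> c) \<or> (\<not> a \<and> b \<and> \<not> c) \<or> (\<not> a \<and> \<not> b \<and> c)"

lemma exactly_one_iff:
  assumes "x \<noteq> y" "x \<noteq> z" "y \<noteq> z"
  shows "(\<exists>!q. q \<in> M \<and> q \<in> {x, y, z}) \<longleftrightarrow> exactly_one (x \<in> M) (y \<in> M) (z \<in> M)"
  using assms by (auto simp: exactly_one_def)

text \<open>
  The external edges of a dimer configuration, as a set of face corners: the dart \<open>d\<close> stands for the
  corner between \<open>d\<close> and \<open>rot G d\<close>, in the left face of \<open>d\<close>. Hence the sector \<open>(d, Lft)\<close> contains the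
  external edge \<open>d\<close>, and the sector \<open>(d, Rgt)\<close> the external edge \<open>inv (rot G) d\<close>.
\<close>

definition external_darts :: "'d qedge set \<Rightarrow> 'd set" where
  "external_darts M = {d. External d \<in> M}"

definition internal_edges :: "'d set \<Rightarrow> 'd qedge set" where
  "internal_edges e = ParEdge ` e \<union> ParDual ` e"

lemma sum_Pow_insert:
  fixes f :: "'a set \<Rightarrow> real"
  assumes "finite A" "a \<notin> A"
  shows "(\<Sum>N\<in>Pow (insert a A). f N) = (\<Sum>N\<in>Pow A. f N) + (\<Sum>N\<in>Pow A. f (insert a N))"
proof -
  have "(\<Sum>N\<in>Pow (insert a A). f N) = (\<Sum>N\<in>Pow A. f N) + (\<Sum>N\<in>insert a ` Pow A. f N)"
    unfolding Pow_insert using assms by (intro sum.union_disjoint) auto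
  also have "(\<Sum>N\<in>insert a ` Pow A. f N) = (\<Sum>N\<in>Pow A. f (insert a N))"
    using assms by (intro sum.reindex_cong[of "insert a"]) (auto simp: inj_on_def)
  finally show ?thesis .
qed

lemma par_weights_squared:
  "par_edge_weight J e * par_edge_weight J e + par_dual_weight J e * par_dual_weight J e = 1"
proof -
  have "(2 * exp (- 2 * J e))\<^sup>2 = 4 * exp (- 4 * J e)"
    by (simp add: power2_eq_square flip: exp_add)
  moreover have "1 + exp (- 4 * J e) \<noteq> 0"
    using exp_gt_zero[of "- 4 * J e"] by linarith
  ultimately show ?thesis
    unfolding par_edge_weight_def par_dual_weight_def
    by (simp add: power2_eq_square add_divide_distrib[symmetric] divide_eq_eq) (simp add: algebra_simps)
qed

context embedded_graph
begin

text \<open>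
  The sets of internal edges of the quadrangle of \<open>e\<close> that complete the external edges \<open>X\<close> into a perfect
  matching of its four corners.
\<close>

definition quadrangle_covers :: "'d set \<Rightarrow> 'd set \<Rightarrow> 'd qedge set set" where
  "quadrangle_covers X e = {N. N \<subseteq> internal_edges e \<and> (\<forall>d\<in>e.
     exactly_one (d \<in> X) (ParEdge d \<in> N) (ParDual d \<in> N) \<and>
     exactly_one (inv (rot G) d \<in> X) (ParEdge (opp G d) \<in> N) (ParDual d \<in> N))}"

lemma qends_Lft: "(d, Lft) \<in> qends G q \<longleftrightarrow> q \<in> {External d, ParEdge d, ParDual d}"
  by (cases q) auto

lemma qends_Rgt:
  assumes "q \<in> qedges G" "d \<in> darts G"
  shows "(d, Rgt) \<in> qends G q \<longleftrightarrow> q \<in> {External (inv (rot G) d), ParEdge (opp G d), ParDual d}"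
  using assms by (cases q) (auto simp: qedges_def)

lemma dimers_iff:
  "M \<in> dimers G \<longleftrightarrow> M \<subseteq> qedges G \<and> (\<forall>d\<in>darts G.
     exactly_one (External d \<in> M) (ParEdge d \<in> M) (ParDual d \<in> M) \<and>
     exactly_one (External (inv (rot G) d) \<in> M) (ParEdge (opp G d) \<in> M) (ParDual d \<in> M))"
proof (cases "M \<subseteq> qedges G")
  case True
  have "(\<exists>!q. q \<in> M \<and> (d, Lft) \<in> qends G q) \<longleftrightarrow>
      exactly_one (External d \<in> M) (ParEdge d \<in> M) (ParDual d \<in> M)" for d
    unfolding qends_Lft by (rule exactly_one_iff) auto
  moreover have "(\<exists>!q. q \<in> M \<and> (d, Rgt) \<in> qends G q) \<longleftrightarrow>
      exactly_one (External (inv (rot G) d) \<in> M) (ParEdge (opp G d) \<in> M) (ParDual d \<in> M)"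
    if "d \<in> darts G" for d
  proof -
    have "(q \<in> M \<and> (d, Rgt) \<in> qends G q) \<longleftrightarrow>
        (q \<in> M \<and> q \<in> {External (inv (rot G) d), ParEdge (opp G d), ParDual d})" for q
      using qends_Rgt[OF _ that, of q] True by blast
    then show ?thesis
      using exactly_one_iff[of "External (inv (rot G) d)" "ParEdge (opp G d)" "ParDual d" M] by simp
  qed
  moreover have "(\<forall>x\<in>qverts G. Q x) \<longleftrightarrow> (\<forall>d\<in>darts G. Q (d, Lft) \<and> Q (d, Rgt))" for Q
    unfolding qverts_def by auto (metis side.exhaust)
  ultimately show ?thesis
    using True by (simp add: dimers_def)
qed (simp add: dimers_def)

lemma internal_edges_disjoint:
  "e \<in> edges G \<Longrightarrow> e' \<in> edges G \<Longrightarrow> e \<noteq> e' \<Longrightarrow> internal_edges e \<inter> internal_edges e' = {}"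
  by (auto simp: internal_edges_def edges_partition)

lemma finite_quadrangle_covers [simp]: "e \<in> edges G \<Longrightarrow> finite (quadrangle_covers X e)"
  by (rule finite_subset[of _ "Pow (internal_edges e)"])
     (auto simp: quadrangle_covers_def internal_edges_def edges_partition)

definition assemble :: "'d set \<Rightarrow> ('d set \<Rightarrow> 'd qedge set) \<Rightarrow> 'd qedge set" where
  "assemble X N = External ` X \<union> (\<Union>e\<in>edges G. N e)"

lemma assemble_facts:
  assumes X: "X \<subseteq> darts G" and N: "\<And>e. e \<in> edges G \<Longrightarrow> N e \<subseteq> internal_edges e"
  shows "External d \<in> assemble X N \<longleftrightarrow> d \<in> X"
    and "d \<in> darts G \<Longrightarrow> ParEdge d \<in> assemble X N \<longleftrightarrow> ParEdge d \<in> N (edge_at G d)"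
    and "d \<in> darts G \<Longrightarrow> ParDual d \<in> assemble X N \<longleftrightarrow> ParDual d \<in> N (edge_at G d)"
    and "assemble X N \<subseteq> qedges G"
    and "e \<in> edges G \<Longrightarrow> assemble X N \<inter> internal_edges e = N e"
proof -
  have int: "d \<in> e" if "e \<in> edges G" "ParEdge d \<in> N e \<or> ParDual d \<in> N e" for d e
    using N[OF that(1)] that(2) by (auto simp: internal_edges_def)
  have noext: "External d \<notin> N e" if "e \<in> edges G" for d e
    using N[OF that] by (auto simp: internal_edges_def)
  show "External d \<in> assemble X N \<longleftrightarrow> d \<in> X"
    using noext by (auto simp: assemble_def)
  show "d \<in> darts G \<Longrightarrow> ParEdge d \<in> assemble X N \<longleftrightarrow> ParEdge d \<in> N (edge_at G d)"
    "d \<in> darts G \<Longrightarrow> ParDual d \<in> assemble X N \<longleftrightarrow> ParDual d \<in> N (edge_at G d)"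
    using int edges_partition(2) by (auto simp: assemble_def)
  show "assemble X N \<subseteq> qedges G"
  proof
    fix q assume "q \<in> assemble X N"
    then consider d where "q = External d" "d \<in> X" | e where "e \<in> edges G" "q \<in> N e"
      by (auto simp: assemble_def)
    then show "q \<in> qedges G"
    proof cases
      case 1
      then show ?thesis using X by (auto simp: qedges_def)
    next
      case 2
      then have "q \<in> internal_edges e" using N by blast
      then show ?thesis
        using edges_partition(2)[OF 2(1)] by (auto simp: qedges_def internal_edges_def)
    qed
  qed
  show "assemble X N \<inter> internal_edges e = N e" if e: "e \<in> edges G"
  proof
    show "N e \<subseteq> assemble X N \<inter> internal_edges e"
      using N e by (auto simp: assemble_def)
    show "assemble X N \<inter> internal_edges e \<subseteq> N e"
    proof
      fix q assume q: "q \<in> assemble X N \<inter> internal_edges e"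
      then have "q \<notin> External ` X" by (auto simp: internal_edges_def)
      then obtain e' where e': "e' \<in> edges G" "q \<in> N e'"
        using q by (auto simp: assemble_def)
      then have "e' = e"
        using N[OF e'(1)] q internal_edges_disjoint[OF e e'(1)] by blast
      then show "q \<in> N e" using e' by simp
    qed
  qed
qed

lemma assemble_eq:
  assumes "M \<subseteq> qedges G"
  shows "assemble (external_darts M) (\<lambda>e\<in>edges G. M \<inter> internal_edges e) = M"
proof (rule set_eqI)
  fix q
  have "ParEdge d \<in> internal_edges (edge_at G d)" "ParDual d \<in> internal_edges (edge_at G d)" for d
    by (auto simp: internal_edges_def edge_at_def)
  then show "q \<in> assemble (external_darts M) (\<lambda>e\<in>edges G. M \<inter> internal_edges e) \<longleftrightarrow> q \<in> M"
    using assms by (cases q) (auto simp: assemble_def external_darts_def qedges_def internal_edges_def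
        intro!: bexI[of _ "edge_at G _"] dest!: subsetD)
qed

lemma assemble_in_dimers:
  assumes "X \<subseteq> darts G" "N \<in> (\<Pi>\<^sub>E e\<in>edges G. quadrangle_covers X e)"
  shows "assemble X N \<in> dimers G"
proof -
  have sub: "N e \<subseteq> internal_edges e" if "e \<in> edges G" for e
    using assms(2) that by (auto simp: quadrangle_covers_def PiE_iff)
  note facts = assemble_facts[OF assms(1), of N, OF sub]
  have "exactly_one (d \<in> X) (ParEdge d \<in> N (edge_at G d)) (ParDual d \<in> N (edge_at G d)) \<and>
      exactly_one (inv (rot G) d \<in> X) (ParEdge (opp G d) \<in> N (edge_at G d)) (ParDual d \<in> N (edge_at G d))"
    if d: "d \<in> darts G" for d
  proof -
    have "N (edge_at G d) \<in> quadrangle_covers X (edge_at G d)"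
      using assms(2) d by (auto simp: PiE_iff)
    moreover have "d \<in> edge_at G d" by (simp add: edge_at_def)
    ultimately show ?thesis unfolding quadrangle_covers_def by blast
  qed
  then show ?thesis
    unfolding dimers_iff using facts by simp
qed

lemma restrict_in_quadrangle_covers:
  assumes "M \<in> dimers G"
  shows "(\<lambda>e\<in>edges G. M \<inter> internal_edges e) \<in> (\<Pi>\<^sub>E e\<in>edges G. quadrangle_covers (external_darts M) e)"
proof -
  have "M \<inter> internal_edges e \<in> quadrangle_covers (external_darts M) e" if e: "e \<in> edges G" for e
  proof -
    have "ParEdge d \<in> internal_edges e" "ParEdge (opp G d) \<in> internal_edges e"
      "ParDual d \<in> internal_edges e" "d \<in> darts G" if "d \<in> e" for d
      using that e by (auto simp: internal_edges_def edges_partition)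
    then show ?thesis
      using assms by (auto simp: quadrangle_covers_def dimers_iff external_darts_def)
  qed
  then show ?thesis by auto
qed

lemma dimer_weight_assemble:
  assumes X: "X \<subseteq> darts G" and N: "\<And>e. e \<in> edges G \<Longrightarrow> N e \<subseteq> internal_edges e"
  shows "dimer_weight G J (assemble X N) = (\<Prod>e\<in>edges G. \<Prod>q\<in>N e. qweight G J q)"
proof -
  have fin: "finite X" "\<And>e. e \<in> edges G \<Longrightarrow> finite (N e)"
    using X N finite_subset[OF X] finite_subset[OF N]
    by (auto simp: internal_edges_def edges_partition)
  have "(\<Union>e\<in>edges G. N e) \<inter> External ` X = {}"
    using N by (force simp: internal_edges_def)
  then have "dimer_weight G J (assemble X N) =
      (\<Prod>q\<in>External ` X. qweight G J q) * (\<Prod>q\<in>(\<Union>e\<in>edges G. N e). qweight G J q)"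
    unfolding dimer_weight_def assemble_def using fin by (intro prod.union_disjoint) auto
  also have "(\<Prod>q\<in>External ` X. qweight G J q) = 1"
    by (rule prod.neutral) auto
  also have "(\<Prod>q\<in>(\<Union>e\<in>edges G. N e). qweight G J q) = (\<Prod>e\<in>edges G. \<Prod>q\<in>N e. qweight G J q)"
  proof (rule prod.UNION_disjoint)
    show "\<forall>e\<in>edges G. \<forall>e'\<in>edges G. e \<noteq> e' \<longrightarrow> N e \<inter> N e' = {}"
      using N internal_edges_disjoint by (meson disjoint_iff subsetD)
  qed (use fin in auto)
  finally show ?thesis by simp
qed

text \<open>
  Each corner of the quadrangle of \<open>e\<close> is an end of exactly one external edge, and otherwise only of
  internal edges of the same quadrangle. So the quadrangles do not interact once the external edges are
  fixed.
\<close>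

lemma sum_dimers_factorizes:
  assumes X: "X \<subseteq> darts G"
  shows "(\<Sum>M | M \<in> dimers G \<and> external_darts M = X. dimer_weight G J M) =
    (\<Prod>e\<in>edges G. \<Sum>N\<in>quadrangle_covers X e. \<Prod>q\<in>N. qweight G J q)"
proof -
  have "(\<Prod>e\<in>edges G. \<Sum>N\<in>quadrangle_covers X e. \<Prod>q\<in>N. qweight G J q) =
      (\<Sum>N\<in>(\<Pi>\<^sub>E e\<in>edges G. quadrangle_covers X e). \<Prod>e\<in>edges G. \<Prod>q\<in>N e. qweight G J q)"
    by (rule prod_sum_PiE) auto
  also have "\<dots> = (\<Sum>M | M \<in> dimers G \<and> external_darts M = X. dimer_weight G J M)"
  proof (rule sum.reindex_bij_witness[of _ "\<lambda>M. \<lambda>e\<in>edges G. M \<inter> internal_edges e" "assemble X"])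
    fix N assume N: "N \<in> (\<Pi>\<^sub>E e\<in>edges G. quadrangle_covers X e)"
    then have sub: "N e \<subseteq> internal_edges e" if "e \<in> edges G" for e
      using that by (auto simp: quadrangle_covers_def PiE_iff)
    note facts = assemble_facts[OF X, of N, OF sub]
    show "(\<lambda>e\<in>edges G. assemble X N \<inter> internal_edges e) = N"
      using N facts(5) by (intro ext) (auto simp: PiE_iff extensional_def restrict_def)
    show "assemble X N \<in> {M. M \<in> dimers G \<and> external_darts M = X}"
      using assemble_in_dimers[OF X N] facts(1) by (simp add: external_darts_def)
    show "dimer_weight G J (assemble X N) = (\<Prod>e\<in>edges G. \<Prod>q\<in>N e. qweight G J q)"
      using X sub by (rule dimer_weight_assemble)
  next
    fix M assume "M \<in> {M. M \<in> dimers G \<and> external_darts M = X}"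
    then show "assemble X (\<lambda>e\<in>edges G. M \<inter> internal_edges e) = M"
      "(\<lambda>e\<in>edges G. M \<inter> internal_edges e) \<in> (\<Pi>\<^sub>E e\<in>edges G. quadrangle_covers X e)"
      using assemble_eq[of M] restrict_in_quadrangle_covers[of M] by (auto simp: dimers_iff)
  qed
  finally show ?thesis by simp
qed

text \<open>
  The first condition says that at each end of \<open>e\<close> the two sectors are both occupied or both free. Then
  all or none of the four are occupied (weight \<open>1\<close>, which for none is \<open>par_weights_squared\<close>), or just the
  two on one side of the dual of \<open>e\<close>. In the second case just the two on one side of \<open>e\<close> are occupied.
  The remaining patterns leave corners that cannot be matched. The sum runs
  over the subsets of a set of four edges, and each of the sixteen patterns is evaluated separately.
\<close>

lemma quadrangle_sum:
  assumes d: "d \<in> darts G"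
  shows "(\<Sum>N\<in>quadrangle_covers X (edge_at G d). \<Prod>q\<in>N. qweight G J q) =
    (if (d \<in> X \<longleftrightarrow> inv (rot G) d \<in> X) \<and> (opp G d \<in> X \<longleftrightarrow> inv (rot G) (opp G d) \<in> X)
     then if d \<in> X \<longleftrightarrow> opp G d \<in> X then 1 else par_dual_weight J (edge_at G d)
     else if (d \<in> X \<longleftrightarrow> inv (rot G) (opp G d) \<in> X) \<and> (opp G d \<in> X \<longleftrightarrow> inv (rot G) d \<in> X)
     then par_edge_weight J (edge_at G d) else 0)"
proof -
  define p q r s where "p \<longleftrightarrow> d \<in> X" and "q \<longleftrightarrow> opp G d \<in> X"
    and "r \<longleftrightarrow> inv (rot G) d \<in> X" and "s \<longleftrightarrow> inv (rot G) (opp G d) \<in> X"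
  define a b where "a = par_edge_weight J (edge_at G d)" and "b = par_dual_weight J (edge_at G d)"
  define covers where "covers N \<longleftrightarrow>
    exactly_one p (ParEdge d \<in> N) (ParDual d \<in> N) \<and>
    exactly_one r (ParEdge (opp G d) \<in> N) (ParDual d \<in> N) \<and>
    exactly_one q (ParEdge (opp G d) \<in> N) (ParDual (opp G d) \<in> N) \<and>
    exactly_one s (ParEdge d \<in> N) (ParDual (opp G d) \<in> N)" for N
  let ?I = "{ParEdge d, ParEdge (opp G d), ParDual d, ParDual (opp G d)}"
  have "quadrangle_covers X (edge_at G d) = {N \<in> Pow ?I. covers N}"
    using d by (auto simp: quadrangle_covers_def covers_def internal_edges_def edge_at_def
        p_def q_def r_def s_def)
  then have "(\<Sum>N\<in>quadrangle_covers X (edge_at G d). \<Prod>q\<in>N. qweight G J q) =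
      (\<Sum>N\<in>Pow ?I. if covers N then \<Prod>q\<in>N. qweight G J q else 0)"
    by (simp only: sum.inter_filter finite_Pow_iff finite_insert finite.emptyI)
  also have "\<dots> = (if (p \<longleftrightarrow> r) \<and> (q \<longleftrightarrow> s) then if p \<longleftrightarrow> q then 1 else b
      else if (p \<longleftrightarrow> s) \<and> (q \<longleftrightarrow> r) then a else 0)"
  proof -
    have w: "qweight G J (ParEdge d) = a" "qweight G J (ParEdge (opp G d)) = a"
      "qweight G J (ParDual d) = b" "qweight G J (ParDual (opp G d)) = b"
      using d by (simp_all add: a_def b_def par_edge_weight_def par_dual_weight_def Let_def)
    have ab: "a * a + b * b = 1"
      unfolding a_def b_def by (rule par_weights_squared)
    show ?thesis
      using d ab w
      by (cases p; cases q; cases r; cases s)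
        (simp_all add: sum_Pow_insert covers_def exactly_one_def del: qweight.simps)
  qed
  finally show ?thesis
    by (simp add: p_def q_def r_def s_def a_def b_def)
qed

section \<open>Dimers with a given first polygon\<close>

lemma finite_dimers [simp]: "finite (dimers G)"
  by (rule finite_subset[of _ "Pow (qedges G)"]) (auto simp: dimers_def qedges_def)

lemma external_darts_subset: "M \<in> dimers G \<Longrightarrow> external_darts M \<subseteq> darts G"
  by (auto simp: dimers_def external_darts_def qedges_def)

text \<open>
  An internal edge joins a left and a right corner. So equally many left and right corners of a quadrangle
  are occupied by external edges, which excludes the patterns that \<open>quadrangle_sum\<close> weighs by \<open>0\<close>.
\<close>

lemma dimer_balanced:
  assumes "M \<in> dimers G" "d \<in> darts G"
  defines "X \<equiv> external_darts M"
  shows "((d \<in> X \<longleftrightarrow> inv (rot G) d \<in> X) \<and> (opp G d \<in> X \<longleftrightarrow> inv (rot G) (opp G d) \<in> X)) \<or>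
    ((d \<in> X \<longleftrightarrow> inv (rot G) d \<notin> X) \<and> (opp G d \<in> X \<longleftrightarrow> d \<notin> X) \<and>
     (inv (rot G) (opp G d) \<in> X \<longleftrightarrow> d \<in> X))"
proof -
  have *: "exactly_one (c \<in> X) (ParEdge c \<in> M) (ParDual c \<in> M)"
    "exactly_one (inv (rot G) c \<in> X) (ParEdge (opp G c) \<in> M) (ParDual c \<in> M)"
    if "c \<in> darts G" for c
    using assms that by (auto simp: dimers_iff external_darts_def)
  show ?thesis
    using *[OF \<open>d \<in> darts G\<close>] *[of "opp G d"] \<open>d \<in> darts G\<close>
    by (simp add: exactly_one_def) argo
qed

text \<open>
  By \<open>dimer_balanced\<close>, the two sectors at one end of the edge can only differ if the occupied sectors
  are the two on one side of the edge.
\<close>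

lemma edge_at_in_Poly1:
  assumes "M \<in> dimers G" "d \<in> darts G"
  shows "edge_at G d \<in> Poly1 G M \<longleftrightarrow> (d \<in> external_darts M) \<noteq> (inv (rot G) d \<in> external_darts M)"
proof -
  let ?X = "external_darts M"
  have present: "(c, Lft) \<in> present_sectors G M (edge_at G d) \<longleftrightarrow> c \<in> edge_at G d \<and> c \<in> ?X"
    "(c, Rgt) \<in> present_sectors G M (edge_at G d) \<longleftrightarrow> c \<in> edge_at G d \<and> inv (rot G) c \<in> ?X" for c
    by (auto simp: present_sectors_def external_darts_def)
  have sides: "present_sectors G M (edge_at G d) = {(c, Lft), (opp G c, Rgt)} \<longleftrightarrow>
      c \<in> ?X \<and> opp G c \<notin> ?X \<and> inv (rot G) c \<notin> ?X \<and> inv (rot G) (opp G c) \<in> ?X"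
    if c: "c \<in> edge_at G d" for c
  proof -
    have cc: "edge_at G d = {c, opp G c}" "c \<noteq> opp G c"
      using c \<open>d \<in> darts G\<close> by (auto simp: edge_at_def)
    have "present_sectors G M (edge_at G d) = {(c, Lft), (opp G c, Rgt)} \<longleftrightarrow>
        (\<forall>x\<in>edge_at G d. ((x, Lft) \<in> present_sectors G M (edge_at G d) \<longleftrightarrow> x = c) \<and>
          ((x, Rgt) \<in> present_sectors G M (edge_at G d) \<longleftrightarrow> x = opp G c))"
      (is "?S = ?T \<longleftrightarrow> ?rhs")
    proof
      assume ?rhs
      show "?S = ?T"
      proof (rule set_eqI)
        fix x :: "'d \<times> side"
        obtain c' t where x: "x = (c', t)" by (cases x)
        have c: "c \<in> edge_at G d" "opp G c \<in> edge_at G d"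
          using cc by auto
        have "(c', Lft) \<in> ?S \<longleftrightarrow> c' = c" "(c', Rgt) \<in> ?S \<longleftrightarrow> c' = opp G c"
          using \<open>?rhs\<close> present[of c'] c by blast+
        then show "x \<in> ?S \<longleftrightarrow> x \<in> ?T"
          unfolding x by (cases t) simp_all
      qed
    qed (use cc in auto)
    then show ?thesis
      unfolding present using cc by auto
  qed
  have "edge_at G d \<in> Poly1 G M \<longleftrightarrow>
      (\<exists>c\<in>{d, opp G d}. c \<in> ?X \<and> opp G c \<notin> ?X \<and> inv (rot G) c \<notin> ?X \<and> inv (rot G) (opp G c) \<in> ?X)"
    using sides assms(2) edge_at_in_edges[OF assms(2)] by (simp add: Poly1_def) (simp add: edge_at_def)
  then show ?thesis
    using dimer_balanced[OF assms] assms(2) by simp argo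
qed

text \<open>
  For a set \<open>P\<close> of edges: the sets of corners that have first polygon \<open>P\<close> and extend to a dimer configuration, described by
  comparing the corners at the two sides of a dart and at the two ends of an edge.
\<close>

definition external_configs :: "'d set set \<Rightarrow> 'd set set" where
  "external_configs P = {X. X \<subseteq> darts G \<and> (\<forall>d\<in>darts G.
     if edge_at G d \<in> P then (inv (rot G) d \<in> X \<longleftrightarrow> d \<notin> X) \<and> (opp G d \<in> X \<longleftrightarrow> d \<notin> X)
     else (inv (rot G) d \<in> X \<longleftrightarrow> d \<in> X))}"

lemma finite_external_configs [simp]: "finite (external_configs P)"
  by (rule finite_subset[of _ "Pow (darts G)"]) (auto simp: external_configs_def)

lemma Poly1_eq_iff:
  assumes M: "M \<in> dimers G" and P: "P \<subseteq> edges G"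
  shows "Poly1 G M = P \<longleftrightarrow> external_darts M \<in> external_configs P"
proof
  assume "Poly1 G M = P"
  then show "external_darts M \<in> external_configs P"
    using external_darts_subset[OF M] edge_at_in_Poly1[OF M] dimer_balanced[OF M]
    unfolding external_configs_def by auto
next
  assume "external_darts M \<in> external_configs P"
  then have "edge_at G d \<in> Poly1 G M \<longleftrightarrow> edge_at G d \<in> P" if "d \<in> darts G" for d
    using edge_at_in_Poly1[OF M that] that
    by (cases "edge_at G d \<in> P") (auto simp: external_configs_def)
  then have "e \<in> Poly1 G M \<longleftrightarrow> e \<in> P" if "e \<in> edges G" for e
    using edge_cases[OF that] by metis
  moreover have "Poly1 G M \<subseteq> edges G"
    by (auto simp: Poly1_def)
  ultimately show "Poly1 G M = P"
    using P by (meson subset_antisym subset_eq)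
qed

text \<open>
  The corners in the faces of \<open>S\<close>, with presence and absence exchanged around the vertices of spin
  \<open>-1\<close>.
\<close>

definition external_config :: "'d set set \<Rightarrow> ('d set \<Rightarrow> real) \<Rightarrow> 'd set" where
  "external_config S \<tau> = {d \<in> darts G. (left_face d \<in> S) \<noteq> (\<tau> (vertex_at G d) = -1)}"

text \<open>
  Turning around a vertex keeps the spin and changes membership in \<open>S\<close> exactly across the edges of \<open>P\<close>;
  going to the other end of an edge of \<open>P\<close> keeps the spin and exchanges left and right.
\<close>

lemma external_config_in:
  assumes \<tau>: "\<tau> \<in> spins G" and P: "P = face_boundary G S" and one: "\<And>e. e \<in> P \<Longrightarrow> edge_spin G \<tau> e = 1"
  shows "external_config S \<tau> \<in> external_configs P"
proof -
  have "if edge_at G d \<in> P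
      then (inv (rot G) d \<in> external_config S \<tau> \<longleftrightarrow> d \<notin> external_config S \<tau>) \<and>
        (opp G d \<in> external_config S \<tau> \<longleftrightarrow> d \<notin> external_config S \<tau>)
      else (inv (rot G) d \<in> external_config S \<tau> \<longleftrightarrow> d \<in> external_config S \<tau>)" if d: "d \<in> darts G" for d
  proof -
    have "\<tau> (vertex_at G (opp G d)) = -1 \<longleftrightarrow> \<tau> (vertex_at G d) = -1" if "edge_at G d \<in> P"
      using one[OF that] d spins_values(1)[OF \<tau>, of d] spins_values(1)[OF \<tau>, of "opp G d"]
      by (auto simp: edge_spin_edge_at)
    then show ?thesis
      using d face_boundary_edge_at[OF d, of S] left_face_inv_rot[OF d]
      unfolding P external_config_def by auto
  qed
  moreover have "external_config S \<tau> \<subseteq> darts G"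
    by (auto simp: external_config_def)
  ultimately show ?thesis
    unfolding external_configs_def by blast
qed

lemma vertex_invariant:
  assumes "\<And>d. d \<in> darts G \<Longrightarrow> h (inv (rot G) d) = h d" "d \<in> darts G" "d' \<in> vertex_at G d"
  shows "h d' = h d"
proof -
  have "d' \<in> darts G \<and> h d' = h d"
    using assms(3) unfolding vertex_at_def
  proof induction
    case base
    then show ?case using assms(1)[of "rot G d"] assms(2) by simp
  next
    case (step y)
    then show ?case using assms(1)[of "rot G y"] by simp
  qed
  then show ?thesis ..
qed

text \<open>
  Relative to the corners in the faces of \<open>S\<close>, the presence of corners no longer changes around a
  vertex, so it is given by a spin there; the condition at the two ends of the edges of \<open>P\<close> makes this spin
  constant along them.
\<close>

lemma external_config_surj:
  assumes X: "X \<in> external_configs P" and P: "P = face_boundary G S"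
  shows "\<exists>\<tau>\<in>spins G. (\<forall>e\<in>P. edge_spin G \<tau> e = 1) \<and> external_config S \<tau> = X"
proof -
  define h where "h d \<longleftrightarrow> (d \<in> X) \<noteq> (left_face d \<in> S)" for d
  define \<tau> where "\<tau> = (\<lambda>v\<in>verts G. if \<exists>d\<in>v. h d then -1 else 1 :: real)"
  have X': "X \<subseteq> darts G" "\<And>d. d \<in> darts G \<Longrightarrow> 
      if edge_at G d \<in> P then (inv (rot G) d \<in> X \<longleftrightarrow> d \<notin> X) \<and> (opp G d \<in> X \<longleftrightarrow> d \<notin> X)
      else (inv (rot G) d \<in> X \<longleftrightarrow> d \<in> X)"
    using X by (auto simp: external_configs_def)
  have inv: "h (inv (rot G) d) = h d" if d: "d \<in> darts G" for d
    using X'(2)[OF d] left_face_inv_rot[OF d] face_boundary_edge_at[OF d, of S]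
    unfolding P h_def by (auto split: if_splits)
  have \<tau>_eq: "\<tau> (vertex_at G d) = (if h d then -1 else 1)" if d: "d \<in> darts G" for d
  proof -
    have "(\<exists>d'\<in>vertex_at G d. h d') \<longleftrightarrow> h d"
      using vertex_invariant[of h, OF inv d] dart_in_vertex[of d] by blast
    then show ?thesis using d by (simp add: \<tau>_def)
  qed
  have "\<tau> \<in> spins G"
    by (auto simp: \<tau>_def spins_def)
  moreover have "edge_spin G \<tau> e = 1" if e: "e \<in> P" for e
  proof -
    obtain d where d: "d \<in> darts G" "e = edge_at G d"
      using e face_boundary_subset edge_cases unfolding P by blast
    have "h (opp G d) = h d"
      using X'(2)[OF d(1)] face_boundary_edge_at[OF d(1), of S] e d(2)
      unfolding P h_def by auto
    then show ?thesis
      using d by (simp add: edge_spin_edge_at \<tau>_eq)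
  qed
  moreover have "external_config S \<tau> = X"
    using X'(1) by (auto simp: external_config_def \<tau>_eq h_def split: if_splits)
  ultimately show ?thesis by blast
qed

lemma external_config_inj:
  assumes "\<tau> \<in> spins G" "\<tau>' \<in> spins G" "external_config S \<tau> = external_config S \<tau>'"
  shows "\<tau> = \<tau>'"
proof -
  have "\<tau> (vertex_at G d) = \<tau>' (vertex_at G d)" if d: "d \<in> darts G" for d
  proof -
    have "d \<in> external_config S \<tau> \<longleftrightarrow> d \<in> external_config S \<tau>'"
      using assms(3) by simp
    then have "\<tau> (vertex_at G d) = -1 \<longleftrightarrow> \<tau>' (vertex_at G d) = -1"
      using d by (auto simp: external_config_def)
    then show ?thesis
      using spins_values(1)[OF assms(1) d] spins_values(1)[OF assms(2) d] by metis
  qed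
  then show ?thesis
    using assms unfolding spins_def by (intro PiE_ext) (auto simp: verts_def)
qed

text \<open>
  The faces on the two sides of an edge off \<open>P\<close> are both in \<open>S\<close> or both outside, so the corners at its two
  ends are occupied alike exactly if the spins there agree.
\<close>

lemma quadrangle_sum_external_config:
  assumes \<tau>: "\<tau> \<in> spins G" and P: "P = face_boundary G S"
    and one: "\<And>e. e \<in> P \<Longrightarrow> edge_spin G \<tau> e = 1" and e: "e \<in> edges G"
  shows "(\<Sum>N\<in>quadrangle_covers (external_config S \<tau>) e. \<Prod>q\<in>N. qweight G J q) =
    (if e \<in> P then (if edge_spin G \<tau> e = 1 then par_edge_weight J e else 0)
     else if edge_spin G \<tau> e = 1 then 1 else par_dual_weight J e)"
proof -
  obtain d where d: "d \<in> darts G" "e = edge_at G d"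
    using e by (rule edge_cases)
  let ?X = "external_config S \<tau>"
  have cond: "if edge_at G c \<in> P
      then (inv (rot G) c \<in> ?X \<longleftrightarrow> c \<notin> ?X) \<and> (opp G c \<in> ?X \<longleftrightarrow> c \<notin> ?X)
      else (inv (rot G) c \<in> ?X \<longleftrightarrow> c \<in> ?X)" if "c \<in> darts G" for c
    using external_config_in[OF \<tau> P one] that by (simp add: external_configs_def)
  show ?thesis
  proof (cases "e \<in> P")
    case True
    then show ?thesis
      using cond[of d] cond[of "opp G d"] one[OF True] d by (simp add: quadrangle_sum)
  next
    case False
    have "left_face d \<in> S \<longleftrightarrow> left_face (opp G d) \<in> S"
      using False d face_boundary_edge_at[OF d(1)] by (simp add: P)
    then have "(d \<in> ?X \<longleftrightarrow> opp G d \<in> ?X) \<longleftrightarrow> edge_spin G \<tau> e = 1"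
      using d spins_values(1)[OF \<tau>, of d] spins_values(1)[OF \<tau>, of "opp G d"]
      by (auto simp: external_config_def edge_spin_edge_at)
    then show ?thesis
      using cond[of d] cond[of "opp G d"] False d by (simp add: quadrangle_sum)
  qed
qed

lemma sum_dimers_Poly1:
  assumes P: "P \<in> polygons_of_class G (zero_class G)"
  shows "(\<Sum>M | M \<in> dimers G \<and> Poly1 G M = P. dimer_weight G J M) =
    (\<Sum>\<tau>\<in>spins G. contour_weight J P \<tau>)"
proof -
  obtain S where S: "P = face_boundary G S"
    using P by (auto simp: zero_class_iff)
  let ?T = "{\<tau> \<in> spins G. \<forall>e\<in>P. edge_spin G \<tau> e = 1}"
  have sub: "P \<subseteq> edges G"
    using S face_boundary_subset by simp
  have "{M. M \<in> dimers G \<and> Poly1 G M = P} = {M \<in> dimers G. external_darts M \<in> external_configs P}"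
    using Poly1_eq_iff[OF _ sub] by auto
  then have "(\<Sum>M | M \<in> dimers G \<and> Poly1 G M = P. dimer_weight G J M) =
      (\<Sum>M | M \<in> dimers G \<and> external_darts M \<in> external_configs P. dimer_weight G J M)"
    by simp
  also have "\<dots> = (\<Sum>X\<in>external_configs P. \<Sum>M | M \<in> {M. M \<in> dimers G \<and> external_darts M \<in> external_configs P} \<and>
      external_darts M = X. dimer_weight G J M)"
    by (rule sum.group[symmetric]) auto
  also have "\<dots> = (\<Sum>X\<in>external_configs P. \<Sum>M | M \<in> dimers G \<and> external_darts M = X. dimer_weight G J M)"
    by (intro sum.cong refl) auto
  also have "\<dots> = (\<Sum>X\<in>external_configs P. \<Prod>e\<in>edges G. \<Sum>N\<in>quadrangle_covers X e. \<Prod>q\<in>N. qweight G J q)"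
    by (intro sum.cong refl sum_dimers_factorizes) (auto simp: external_configs_def)
  also have "\<dots> = (\<Sum>\<tau>\<in>?T. contour_weight J P \<tau>)"
  proof (rule sum.reindex_cong[of "external_config S"])
    show "inj_on (external_config S) ?T"
      by (auto intro!: inj_onI external_config_inj)
    show "external_configs P = external_config S ` ?T"
      using external_config_in[OF _ S] external_config_surj[OF _ S] by fastforce
    show "(\<Prod>e\<in>edges G. \<Sum>N\<in>quadrangle_covers (external_config S \<tau>) e. \<Prod>q\<in>N. qweight G J q) =
        contour_weight J P \<tau>" if "\<tau> \<in> ?T" for \<tau>
      unfolding contour_weight_def using that
      by (intro prod.cong refl quadrangle_sum_external_config[OF _ S]) auto
  qed
  also have "\<dots> = (\<Sum>\<tau>\<in>spins G. contour_weight J P \<tau>)"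
  proof (rule sum.mono_neutral_left)
    show "\<forall>\<tau>\<in>spins G - ?T. contour_weight J P \<tau> = 0"
    proof
      fix \<tau> assume "\<tau> \<in> spins G - ?T"
      then obtain e where "e \<in> P" "edge_spin G \<tau> e \<noteq> 1" by blast
      then show "contour_weight J P \<tau> = 0"
        unfolding contour_weight_def using sub by (intro prod_zero) auto
    qed
  qed auto
  finally show ?thesis .
qed

section \<open>Comparison of the two models\<close>

lemma dimer_weight_nonneg:
  assumes M: "M \<in> dimers G" and J: "\<And>e. e \<in> edges G \<Longrightarrow> J e > 0"
  shows "dimer_weight G J M \<ge> 0"
  unfolding dimer_weight_def
proof (rule prod_nonneg)
  fix q assume "q \<in> M"
  then have q: "q \<in> qedges G" using M by (auto simp: dimers_def)
  then show "0 \<le> qweight G J q"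
  proof (cases q)
    case (ParDual d)
    then have "J (edge_at G d) > 0"
      using q J by (auto simp: qedges_def)
    then show ?thesis
      using ParDual by (simp add: Let_def)
  qed (simp_all add: Let_def)
qed

lemma sum_by_zero_class_polygon:
  assumes "finite A" "f ` A \<subseteq> polygons_of_class G (zero_class G)"
  shows "sum h A = (\<Sum>P\<in>polygons_of_class G (zero_class G). \<Sum>w | w \<in> A \<and> f w = P. h w)"
  using assms by (intro sum.group[symmetric]) auto

end

lemma measure_point_measure_normalized:
  fixes h :: "'a \<Rightarrow> real"
  assumes "finite A" and h: "\<And>w. w \<in> A \<Longrightarrow> 0 \<le> h w" and "0 \<le> Z"
  shows "measure (point_measure A (\<lambda>w. ennreal (h w / Z)))
      {w \<in> space (point_measure A (\<lambda>w. ennreal (h w / Z))). f w = P} =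
    (\<Sum>w | w \<in> A \<and> f w = P. h w) / Z"
proof -
  let ?B = "{w. w \<in> A \<and> f w = P}"
  have "emeasure (point_measure A (\<lambda>w. ennreal (h w / Z))) ?B = (\<Sum>w\<in>?B. ennreal (h w / Z))"
    using assms by (intro emeasure_point_measure_finite) auto
  also have "\<dots> = ennreal (\<Sum>w\<in>?B. h w / Z)"
    using assms by (intro sum_ennreal) auto
  finally show ?thesis
    using assms by (auto simp: measure_def space_point_measure sum_divide_distrib intro!: enn2real_ennreal sum_nonneg)
qed

theorem theorem19:
  fixes G :: "'d cmap" and g :: nat and J :: "'d set \<Rightarrow> real"
    and rep :: "'d set set set \<Rightarrow> 'd set set"
  assumes "cellular_map G"
    and "euler_char G = 2 - 2 * int g"
    and "\<And>e. e \<in> edges (dual G) \<Longrightarrow> J e > 0"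
    and "\<And>\<epsilon>. \<epsilon> \<in> H1 G \<Longrightarrow> rep \<epsilon> \<in> polygons_of_class G \<epsilon>"
  shows "Z_dIsing G rep J =
           2 ^ (card (verts (dual G)) + 2 * g) * (\<Prod>e\<in>edges G. cosh (2 * J e)) * Z0_quadri G J
       \<and> (\<forall>P \<in> polygons_of_class G (zero_class G).
           measure (dIsing_measure G rep J)
             {w \<in> space (dIsing_measure G rep J). xor_polygon G rep w = P}
         = measure (quadri0_measure G J)
             {M \<in> space (quadri0_measure G J). Poly1 G M = P})"
proof -
  interpret embedded_graph G
    using assms(1) by unfold_locales
  define K where "K = 2 ^ (card (verts (dual G)) + 2 * g) * (\<Prod>e\<in>edges G. cosh (2 * J e))"
  let ?P0 = "polygons_of_class G (zero_class G)"
  have J: "J e > 0" if "e \<in> edges G" for e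
    using assms(3) that by simp
  have "K > 0"
    unfolding K_def by (intro mult_pos_pos prod_pos) auto
  have xor: "xor_polygon G rep w = (case w of (R, B) \<Rightarrow> sym_diff R B)" if "w \<in> homologous G" for w
    using xor_polygon_eq[OF assms(4)] that by (cases w) simp
  have slice: "(\<Sum>w | w \<in> homologous G \<and> xor_polygon G rep w = P. dIsing_weight G J w) =
      K * (\<Sum>M | M \<in> dimers0 G \<and> Poly1 G M = P. dimer_weight G J M)" if P: "P \<in> ?P0" for P
  proof -
    have "{w. w \<in> homologous G \<and> xor_polygon G rep w = P} =
        {w. w \<in> homologous G \<and> (case w of (R, B) \<Rightarrow> sym_diff R B) = P}"
      using xor by auto
    moreover have "{M. M \<in> dimers0 G \<and> Poly1 G M = P} = {M. M \<in> dimers G \<and> Poly1 G M = P}"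
      using P by (auto simp: dimers0_def)
    ultimately show ?thesis
      using sum_weight_xor_eq[OF assms(2) P, of J] sum_dimers_Poly1[OF P, of J] by (simp add: K_def)
  qed
  have fin: "finite (dimers0 G)"
    by (rule finite_subset[OF _ finite_dimers]) (auto simp: dimers0_def)
  have Z_eq: "Z_dIsing G rep J = K * Z0_quadri G J"
  proof -
    have "xor_polygon G rep ` homologous G \<subseteq> ?P0"
    proof clarify
      fix R B assume RB: "(R, B) \<in> homologous G"
      have "xor_polygon G rep (R, B) = sym_diff R B"
        using xor[OF RB] by simp
      then show "xor_polygon G rep (R, B) \<in> ?P0"
        using RB unfolding zero_class_iff homologous_iff by simp
    qed
    then have "Z_dIsing G rep J =
        (\<Sum>P\<in>?P0. \<Sum>w | w \<in> homologous G \<and> xor_polygon G rep w = P. dIsing_weight G J w)"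
      using Z_dIsing_sum_weights[of rep J, OF assms(4)]
        sum_by_zero_class_polygon[of "homologous G" "xor_polygon G rep" "dIsing_weight G J"] by simp
    also have "\<dots> = K * (\<Sum>P\<in>?P0. \<Sum>M | M \<in> dimers0 G \<and> Poly1 G M = P. dimer_weight G J M)"
      unfolding sum_distrib_left by (intro sum.cong refl) (simp add: slice sum_distrib_left)
    also have "(\<Sum>P\<in>?P0. \<Sum>M | M \<in> dimers0 G \<and> Poly1 G M = P. dimer_weight G J M) = Z0_quadri G J"
      unfolding Z0_quadri_def
      by (rule sum_by_zero_class_polygon[symmetric]) (use fin in \<open>auto simp: dimers0_def\<close>)
    finally show ?thesis .
  qed
  have "measure (dIsing_measure G rep J) {w \<in> space (dIsing_measure G rep J). xor_polygon G rep w = P} =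
      measure (quadri0_measure G J) {M \<in> space (quadri0_measure G J). Poly1 G M = P}"
    if P: "P \<in> ?P0" for P
  proof -
    have dimer_nonneg: "0 \<le> dimer_weight G J M" if "M \<in> dimers0 G" for M
      using that dimer_weight_nonneg[OF _ J] by (auto simp: dimers0_def)
    then have "0 \<le> Z0_quadri G J"
      unfolding Z0_quadri_def by (rule sum_nonneg)
    have "measure (dIsing_measure G rep J) {w \<in> space (dIsing_measure G rep J). xor_polygon G rep w = P} =
        (\<Sum>w | w \<in> homologous G \<and> xor_polygon G rep w = P. dIsing_weight G J w) / Z_dIsing G rep J"
      unfolding dIsing_measure_def dIsing_configs_eq
    proof (rule measure_point_measure_normalized)
      show "0 \<le> Z_dIsing G rep J"
        using Z_eq \<open>K > 0\<close> \<open>0 \<le> Z0_quadri G J\<close> by simp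
      show "0 \<le> dIsing_weight G J w" for w
        by (auto simp: dIsing_weight_def case_prod_unfold intro!: mult_nonneg_nonneg prod_nonneg)
    qed simp
    also have "\<dots> = (\<Sum>M | M \<in> dimers0 G \<and> Poly1 G M = P. dimer_weight G J M) / Z0_quadri G J"
      using slice[OF P] Z_eq \<open>K > 0\<close> by simp
    also have "\<dots> = measure (quadri0_measure G J) {M \<in> space (quadri0_measure G J). Poly1 G M = P}"
      unfolding quadri0_measure_def
      using fin dimer_nonneg \<open>0 \<le> Z0_quadri G J\<close> by (intro measure_point_measure_normalized[symmetric])
    finally show ?thesis .
  qed
  then show ?thesis
    using Z_eq unfolding K_def by blast
qed

end
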